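(* Let $(\Omega,\Sigma,\mu)$ be a complete finite measure space and let $E$ be an infinite-dimensional separable Banach space. Then the following conditions are equivalent: (i) $(\Omega,\Sigma,\mu)$ is saturated. (ii) For every $\mu$-continuous vector measure $m:\Sigma\to E$, the range $m(\Sigma)$ is weakly compact and convex. (iii) For every nonempty decomposable subset $K$ of $L^1(\mu,E)$, the set $\{\int f\,d\mu\mid f\in K\}$ is convex. In particular, the implications (i) $\Rightarrow$ (ii) and (i) $\Rightarrow$ (iii) are true for every separable Banach space $E$ (not necessarily infinite dimensional).
   Context: $L^1(\mu,E)$ is the Banach space of ($\mu$-equivalence classes of) Bochner integrable functions $f:\Omega\to E$ with norm $\|f\|_1=\int\|f(\omega)\|\,d\mu$, and $\int f\,d\mu\in E$ is the Bochner integral over $\Omega$. A subset $K$ of $L^1(\mu,E)$ is decomposable if $\chi_A f+(1-\chi_A)g\in K$ for every $f,g\in K$ and every $A\in\Sigma$, where $\chi_A$ is the characteristic function of $A$. A vector measure $m:\Sigma\to E$ is a (norm) countably additive set function; it is $\mu$-continuous if it is absolutely continuous with respect to $\mu$, i.e. $m(A)=0$ whenever $\mu(A)=0$. Its range is $m(\Sigma)=\{m(A)\mid A\in\Sigma\}$. For $S\in\Sigma$, let $\Sigma_S=\{A\cap S\mid A\in\Sigma\}$, and let $L^1_S(\mu)$ denote the space of (real-valued) $\mu$-integrable functions on the measurable space $(S,\Sigma_S)$, i.e. the restrictions to $S$ of the functions in $L^1(\mu)$. A finite measure space $(\Omega,\Sigma,\mu)$ is saturated if $L^1_S(\mu)$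 is nonseparable for every $S\in\Sigma$ with $\mu(S)>0$. *)

theory Defs
  imports "HOL-Analysis.Analysis"
begin

text \<open>
  A value type of classes \<open>banach\<close> and \<open>second_countable_topology\<close> is a real separable Banach
  space; there the library's \<open>integrable\<close> and \<open>integral\<^sup>L\<close> are Bochner integrability and the
  Bochner integral.
\<close>

definition L1_rel :: "'a measure \<Rightarrow> (('a \<Rightarrow> 'b::{banach,second_countable_topology}) \<times> ('a \<Rightarrow> 'b)) set"
  where "L1_rel M = {(f, g). integrable M f \<and> integrable M g \<and> (AE x in M. f x = g x)}"

definition L1_space :: "'a measure \<Rightarrow> ('a \<Rightarrow> 'b::{banach,second_countable_topology}) set set"
  where "L1_space M = {f. integrable M f} // L1_rel M"

definition L1_class :: "'a measure \<Rightarrow> ('a \<Rightarrow> 'b::{banach,second_countable_topology}) \<Rightarrow> ('a \<Rightarrow> 'b) set"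
  where "L1_class M f = L1_rel M `` {f}"

definition L1_rep :: "('a \<Rightarrow> 'b) set \<Rightarrow> 'a \<Rightarrow> 'b"
  where "L1_rep F = (SOME f. f \<in> F)"

text \<open>Both operations below do not depend on the choice of representatives; see
  \<open>L1_integral_class\<close> and \<open>L1_dist_class\<close>.\<close>

definition L1_integral :: "'a measure \<Rightarrow> ('a \<Rightarrow> 'b::{banach,second_countable_topology}) set \<Rightarrow> 'b"
  where "L1_integral M F = (\<integral>x. L1_rep F x \<partial>M)"

definition L1_dist :: "'a measure \<Rightarrow> ('a \<Rightarrow> 'b::{banach,second_countable_topology}) set \<Rightarrow> ('a \<Rightarrow> 'b) set \<Rightarrow> real"
  where "L1_dist M F G = (\<integral>x. norm (L1_rep F x - L1_rep G x) \<partial>M)"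

definition decomposable ::
    "'a measure \<Rightarrow> ('a \<Rightarrow> 'b::{banach,second_countable_topology}) set set \<Rightarrow> bool"
  where "decomposable M K \<longleftrightarrow> K \<subseteq> L1_space M \<and>
    (\<forall>F\<in>K. \<forall>G\<in>K. \<forall>f\<in>F. \<forall>g\<in>G. \<forall>A\<in>sets M.
       L1_class M (\<lambda>x. indicator A x *\<^sub>R f x + (1 - indicator A x) *\<^sub>R g x) \<in> K)"

definition vector_measure :: "'a measure \<Rightarrow> ('a set \<Rightarrow> 'b::real_normed_vector) \<Rightarrow> bool"
  where "vector_measure M m \<longleftrightarrow>
    (\<forall>A::nat \<Rightarrow> 'a set. range A \<subseteq> sets M \<longrightarrow> disjoint_family A \<longrightarrow>
       (\<lambda>i. m (A i)) sums m (\<Union>i. A i))"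

definition mu_continuous :: "'a measure \<Rightarrow> ('a set \<Rightarrow> 'b::real_normed_vector) \<Rightarrow> bool"
  where "mu_continuous M m \<longleftrightarrow> (\<forall>A\<in>sets M. emeasure M A = 0 \<longrightarrow> m A = 0)"

text \<open>The coarsest topology making all bounded linear functionals continuous.\<close>

definition weak_topology :: "'b::real_normed_vector topology"
  where "weak_topology =
    topology_generated_by {\<phi> -` U | (\<phi> :: 'b \<Rightarrow> real) U. bounded_linear \<phi> \<and> open U}"

definition saturated :: "'a measure \<Rightarrow> bool"
  where "saturated M \<longleftrightarrow>
    (\<forall>S\<in>sets M. emeasure M S > 0 \<longrightarrow>
       \<not> separable_space (Metric_space.mtopology
            (L1_space (restrict_space M S) :: ('a \<Rightarrow> real) set set) (L1_dist (restrict_space M S))))"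

lemma equiv_L1_rel: "equiv {f. integrable M f} (L1_rel M)"
proof (rule equivI)
  show "L1_rel M \<subseteq> {f. integrable M f} \<times> {f. integrable M f}"
    by (auto simp: L1_rel_def)
  show "refl_on {f. integrable M f} (L1_rel M)"
    by (auto simp: refl_on_def L1_rel_def)
  show "sym (L1_rel M)"
    by (auto simp: sym_def L1_rel_def)
  show "trans (L1_rel M)"
    unfolding trans_def L1_rel_def by auto
qed

lemma L1_class_iff:
  assumes "integrable M f"
  shows "g \<in> L1_class M f \<longleftrightarrow> integrable M g \<and> (AE x in M. f x = g x)"
  using assms by (auto simp: L1_class_def L1_rel_def)

lemma L1_space_eq: "L1_space M = L1_class M ` {f. integrable M f}"
  by (auto simp: L1_space_def L1_class_def quotient_def)

lemma L1_rep_class: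
  assumes "integrable M f"
  shows "integrable M (L1_rep (L1_class M f))" "AE x in M. f x = L1_rep (L1_class M f) x"
proof -
  have "f \<in> L1_class M f" using assms by (simp add: L1_class_iff)
  then have "L1_rep (L1_class M f) \<in> L1_class M f"
    unfolding L1_rep_def by (rule someI[where P = "\<lambda>g. g \<in> L1_class M f"])
  then show "integrable M (L1_rep (L1_class M f))" "AE x in M. f x = L1_rep (L1_class M f) x"
    using assms by (simp_all add: L1_class_iff)
qed

lemma L1_class_rep:
  assumes "F \<in> L1_space M"
  shows "integrable M (L1_rep F)" "L1_class M (L1_rep F) = F"
proof -
  obtain f where f: "integrable M f" "F = L1_class M f"
    using assms by (auto simp: L1_space_eq)
  show "integrable M (L1_rep F)" using L1_rep_class(1)[OF f(1)] f(2) by simp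
  have "(f, L1_rep F) \<in> L1_rel M"
    using L1_rep_class[OF f(1)] f by (simp add: L1_rel_def)
  from equiv_class_eq[OF equiv_L1_rel this] show "L1_class M (L1_rep F) = F"
    using f(2) by (simp add: L1_class_def)
qed

lemma L1_integral_class:
  assumes "integrable M f"
  shows "L1_integral M (L1_class M f) = (\<integral>x. f x \<partial>M)"
  unfolding L1_integral_def
  by (rule integral_cong_AE) (use L1_rep_class[OF assms] assms in auto)

lemma L1_dist_class:
  assumes f: "integrable M f" and g: "integrable M g"
  shows "L1_dist M (L1_class M f) (L1_class M g) = (\<integral>x. norm (f x - g x) \<partial>M)"
  unfolding L1_dist_def
proof (rule integral_cong_AE)
  show "AE x in M. norm (L1_rep (L1_class M f) x - L1_rep (L1_class M g) x) = norm (f x - g x)"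
    using L1_rep_class(2)[OF f] L1_rep_class(2)[OF g] by eventually_elim simp
qed (use L1_rep_class(1)[OF f] L1_rep_class(1)[OF g] f g in auto)

lemma Metric_space_L1: "Metric_space (L1_space M) (L1_dist M)"
proof
  fix F G :: "('a \<Rightarrow> 'b::{banach,second_countable_topology}) set"
  show "0 \<le> L1_dist M F G" by (simp add: L1_dist_def)
  show "L1_dist M F G = L1_dist M G F" by (simp add: L1_dist_def norm_minus_commute)
next
  fix F G :: "('a \<Rightarrow> 'b::{banach,second_countable_topology}) set"
  assume F: "F \<in> L1_space M" and G: "G \<in> L1_space M"
  note [simp] = L1_class_rep(1)[OF F] L1_class_rep(1)[OF G]
  show "L1_dist M F G = 0 \<longleftrightarrow> F = G"
  proof
    assume "L1_dist M F G = 0"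
    then have "AE x in M. norm (L1_rep F x - L1_rep G x) = 0"
      unfolding L1_dist_def by (subst (asm) integral_nonneg_eq_0_iff_AE) auto
    then have "(L1_rep F, L1_rep G) \<in> L1_rel M"
      by (simp add: L1_rel_def)
    then have "L1_class M (L1_rep F) = L1_class M (L1_rep G)"
      unfolding L1_class_def by (rule equiv_class_eq[OF equiv_L1_rel])
    then show "F = G" using L1_class_rep(2)[OF F] L1_class_rep(2)[OF G] by simp
  qed (simp add: L1_dist_def)
next
  fix F G H :: "('a \<Rightarrow> 'b::{banach,second_countable_topology}) set"
  assume F: "F \<in> L1_space M" and G: "G \<in> L1_space M" and H: "H \<in> L1_space M"
  note [simp] = L1_class_rep(1)[OF F] L1_class_rep(1)[OF G] L1_class_rep(1)[OF H]
  have "L1_dist M F H \<le> (\<integral>x. norm (L1_rep F x - L1_rep G x) + norm (L1_rep G x - L1_rep H x) \<partial>M)"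
    unfolding L1_dist_def
  proof (rule integral_mono)
    show "norm (L1_rep F x - L1_rep H x) \<le> norm (L1_rep F x - L1_rep G x) + norm (L1_rep G x - L1_rep H x)" for x
      using norm_triangle_ineq[of "L1_rep F x - L1_rep G x" "L1_rep G x - L1_rep H x"] by simp
  qed simp_all
  also have "\<dots> = L1_dist M F G + L1_dist M G H"
    unfolding L1_dist_def by (rule Bochner_Integration.integral_add) auto
  finally show "L1_dist M F H \<le> L1_dist M F G + L1_dist M G H" .
qed

lemma topspace_weak_topology: "topspace weak_topology = (UNIV :: 'b::real_normed_vector set)"
proof -
  have "(\<lambda>_::'b. 0::real) -` UNIV \<in> {\<phi> -` U | (\<phi> :: 'b \<Rightarrow> real) U. bounded_linear \<phi> \<and> open U}"
    using bounded_linear_zero open_UNIV by blast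
  then have "UNIV \<in> {\<phi> -` U | (\<phi> :: 'b \<Rightarrow> real) U. bounded_linear \<phi> \<and> open U}"
    by (simp only: vimage_UNIV)
  then show ?thesis
    unfolding weak_topology_def topology_generated_by_topspace by blast
qed

end

theory Submission
  imports Defs "HOL-Probability.Conditional_Expectation"
begin

text \<open>
  Fix countably many functionals separating the points of \<open>E\<close>. They turn a \<open>\<mu>\<close>-continuous vector
  measure into countably many densities \<open>h \<in> L\<^sup>1(\<mu>)\<close>, without any Bochner density for the measure
  itself. Countably many functions generate a countably generated \<open>\<sigma>\<close>-algebra \<open>\<D>\<close>, and \<open>L\<^sup>1(\<D>)\<close> is
  separable; so on a saturated space each set \<open>S\<close> of positive measure has a subset \<open>B\<close> that is not
  \<open>\<D>\<close>-measurable modulo null sets, and \<open>1\<^sub>B - E[1\<^sub>B|\<D>]\<close> is a nonzero bounded function supported in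
  \<open>S\<close> and orthogonal to all the \<open>h\<close>. Lindenstrauss' argument then gives the Lyapunov theorem: for
  every \<open>f\<close> with values in \<open>[0,1]\<close> some set \<open>A\<close> satisfies \<open>\<integral>\<^sub>A h = \<integral> f h\<close> for all the \<open>h\<close>. Instead of
  an extreme point of a weak* compact set, it uses a sequence that nearly maximises the \<open>L\<^sup>2\<close> norm
  subject to more and more orthogonality constraints; by Pythagoras it converges, and its limit must
  be an indicator function. Convexity is the case of convex combinations of two indicators. For weak
  compactness, a sequence of indicators has a weak* convergent subsequence, whose limit \<open>f\<close> is
  replaced by a set.

  If \<open>L\<^sup>1\<^sub>S\<close> has a countable dense family \<open>h\<^sub>n\<close>, take \<open>x\<^sub>n \<in> E\<close> and functionals \<open>\<phi>\<^sub>n\<close> with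
  \<open>\<phi>\<^sub>n(x\<^sub>n) \<noteq> 0\<close> and \<open>\<phi>\<^sub>n(x\<^sub>k) = 0\<close> for \<open>k > n\<close>, and let \<open>f = \<Sum>\<^sub>n c\<^sub>n h\<^sub>n x\<^sub>n\<close> with small \<open>c\<^sub>n > 0\<close>. Then
  \<open>g \<mapsto> \<integral> g f\<close> is injective on \<open>L\<^sup>\<infinity>\<^sub>S\<close>, so half of \<open>\<integral>\<^sub>S f\<close> is not of the form \<open>\<integral>\<^sub>A f\<close>.
\<close>

section \<open>Norming functionals\<close>

definition sublinear :: "('v::real_vector \<Rightarrow> real) \<Rightarrow> bool" where
  "sublinear p \<longleftrightarrow> (\<forall>x y. p (x + y) \<le> p x + p y) \<and> (\<forall>c>0. \<forall>x. p (c *\<^sub>R x) \<le> c * p x)"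

text \<open>Homogeneity enters only as an inequality at positive scalars, the form that infima
  inherit; applying it with \<open>1 / c\<close> gives the reverse inequality.\<close>

lemma sublinearD:
  assumes "sublinear p"
  shows sublinear_add: "p (x + y) \<le> p x + p y"
    and sublinear_scale: "c > 0 \<Longrightarrow> p (c *\<^sub>R x) = c * p x"
    and sublinear_zero: "p 0 = 0"
    and sublinear_minus: "- p (- x) \<le> p x"
proof -
  have le: "p (c *\<^sub>R x) \<le> c * p x" if "c > 0" for c x
    using assms that by (simp add: sublinear_def)
  have scale: "p (c *\<^sub>R x) = c * p x" if "c > 0" for c x
  proof (rule antisym)
    show "p (c *\<^sub>R x) \<le> c * p x" using that by (rule le)
    have "p ((1 / c) *\<^sub>R (c *\<^sub>R x)) \<le> (1 / c) * p (c *\<^sub>R x)"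
      by (rule le) (use that in simp)
    then show "c * p x \<le> p (c *\<^sub>R x)"
      using that by (simp add: field_simps)
  qed
  show add: "p (x + y) \<le> p x + p y" for x y
    using assms by (simp add: sublinear_def)
  show "c > 0 \<Longrightarrow> p (c *\<^sub>R x) = c * p x" by (rule scale)
  show zero: "p 0 = 0" using scale[of 2 0] by simp
  show "- p (- x) \<le> p x" using add[of x "- x"] zero by simp
qed

text \<open>The infimum of \<open>p (x + t *\<^sub>R y) - t * p y\<close> over
  \<open>t \<ge> 0\<close> works: \<open>t = 0\<close> puts it below \<open>p\<close>, and
  \<open>t = 1\<close> at the point \<open>- y\<close> gives the last bound. The purpose is to lower
  \<open>p\<close> until it is odd at \<open>y\<close>.\<close>

lemma sublinear_shift:
  fixes p :: "'v::real_vector \<Rightarrow> real"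
  assumes p: "sublinear p"
  obtains q where "sublinear q" "q \<le> p" "q (- y) \<le> - p y"
proof -
  define q where "q = (\<lambda>x. INF t\<in>{0..}. p (x + t *\<^sub>R y) - t * p y)"
  \<comment> \<open>A lower bound independent of \<open>t\<close>, so that the real infimum
    \<open>q x\<close> is a genuine greatest lower bound.\<close>
  have lower: "- p (- x) \<le> p (x + t *\<^sub>R y) - t * p y" if "t \<ge> 0" for x t
  proof (cases "t = 0")
    case False
    then have "t * p y = p (t *\<^sub>R y)"
      using sublinear_scale[OF p, of t y] that by simp
    also have "\<dots> \<le> p (x + t *\<^sub>R y) + p (- x)"
      using sublinear_add[OF p, of "x + t *\<^sub>R y" "- x"] by simp
    finally show ?thesis by simp
  qed (use sublinear_minus[OF p] in simp)
  have bdd: "bdd_below ((\<lambda>t. p (x + t *\<^sub>R y) - t * p y) ` {0..})" for x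
    using lower by (auto intro!: bdd_belowI2)
  have q_le: "q x \<le> p (x + t *\<^sub>R y) - t * p y" if "t \<ge> 0" for x t
    unfolding q_def using that by (intro cINF_lower bdd) auto
  have q_ge: "u \<le> q x" if "\<And>t. t \<ge> 0 \<Longrightarrow> u \<le> p (x + t *\<^sub>R y) - t * p y" for u x
    unfolding q_def using that by (intro cINF_greatest) auto
  have "sublinear q"
    unfolding sublinear_def
  proof (intro conjI allI impI)
    fix x x'
    \<comment> \<open>The two infima on the right are taken one after the other; parameters
      \<open>s\<close> for \<open>x\<close> and \<open>t\<close> for \<open>x'\<close> combine to
      \<open>s + t\<close> for the sum.\<close>
    have "q (x + x') - q x' \<le> q x"
    proof (rule q_ge)
      fix s :: real assume s: "s \<ge> 0"
      have "q (x + x') - (p (x + s *\<^sub>R y) - s * p y) \<le> q x'"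
      proof (rule q_ge)
        fix t :: real assume t: "t \<ge> 0"
        have "p (x + x' + (s + t) *\<^sub>R y) \<le> p (x + s *\<^sub>R y) + p (x' + t *\<^sub>R y)"
          using sublinear_add[OF p, of "x + s *\<^sub>R y" "x' + t *\<^sub>R y"] by (simp add: algebra_simps)
        then show "q (x + x') - (p (x + s *\<^sub>R y) - s * p y) \<le> p (x' + t *\<^sub>R y) - t * p y"
          using q_le[of "s + t" "x + x'"] s t by (simp add: algebra_simps)
      qed
      then show "q (x + x') - q x' \<le> p (x + s *\<^sub>R y) - s * p y" by simp
    qed
    then show "q (x + x') \<le> q x + q x'" by simp
  next
    fix c :: real and x assume c: "c > 0"
    have "q (c *\<^sub>R x) / c \<le> q x"
    proof (rule q_ge)
      fix t :: real assume t: "t \<ge> 0"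
      have "q (c *\<^sub>R x) \<le> p (c *\<^sub>R (x + t *\<^sub>R y)) - c * t * p y"
        using q_le[of "c * t" "c *\<^sub>R x"] c t by (simp add: scaleR_add_right)
      also have "\<dots> = c * (p (x + t *\<^sub>R y) - t * p y)"
        by (subst sublinear_scale[OF p c]) (simp add: right_diff_distrib)
      finally show "q (c *\<^sub>R x) / c \<le> p (x + t *\<^sub>R y) - t * p y"
        using c by (simp add: field_simps)
    qed
    then show "q (c *\<^sub>R x) \<le> c * q x" using c by (simp add: field_simps)
  qed
  moreover have "q \<le> p" using q_le[of 0] by (simp add: le_fun_def)
  moreover have "q (- y) \<le> - p y" using q_le[of 1 "- y"] sublinear_zero[OF p] by simp
  ultimately show ?thesis by (rule that)
qed

text \<open>By minimality, \<open>sublinear_shift\<close> returns \<open>p\<close> itself, so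
  \<open>p\<close> is odd in every direction; an odd subadditive function is additive.\<close>

lemma minimal_sublinear_imp_linear:
  fixes p :: "'v::real_vector \<Rightarrow> real"
  assumes p: "sublinear p" and minimal: "\<And>q. sublinear q \<Longrightarrow> q \<le> p \<Longrightarrow> q = p"
  shows "linear p"
proof -
  have neg: "p (- y) = - p y" for y
    using sublinear_shift[OF p, of y] minimal sublinear_minus[OF p, of y] by (metis antisym minus_le_iff)
  have add: "p (x + y) = p x + p y" for x y
    using sublinear_add[OF p, of x y] sublinear_add[OF p, of "x + y" "- y"] neg[of y] by simp
  have "p (c *\<^sub>R x) = c * p x" for c x
  proof (cases c "0::real" rule: linorder_cases)
    case less
    then have "p (- ((- c) *\<^sub>R x)) = c * p x"
      unfolding neg using sublinear_scale[OF p, of "- c" x] by simp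
    then show ?thesis by simp
  qed (use sublinear_scale[OF p] sublinear_zero[OF p] in auto)
  with add show ?thesis by (intro linearI) auto
qed

lemma sublinear_dominates_linear:
  fixes p :: "'v::real_vector \<Rightarrow> real"
  assumes p: "sublinear p"
  obtains l where "linear l" "l \<le> p"
proof -
  define A where "A = {q. sublinear q \<and> q \<le> p}"
  have "\<exists>m\<in>A. \<forall>a\<in>A. a \<le> m \<longrightarrow> a = m"
  \<comment> \<open>Zorn's lemma for the reversed order: its maximal elements are the minimal
    sublinear functionals below \<open>p\<close>.\<close>
  proof (rule predicate_Zorn[where P = "\<lambda>a b. b \<le> a"])
    show "partial_order_on A (relation_of (\<lambda>a b. b \<le> a) A)"
      by (rule partial_order_on_relation_ofI) auto
  next
    fix C assume "C \<in> Chains (relation_of (\<lambda>a b. b \<le> a) A)"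
    then have C: "C \<subseteq> A" and chain: "\<And>a b. a \<in> C \<Longrightarrow> b \<in> C \<Longrightarrow> a \<le> b \<or> b \<le> a"
      by (auto simp: Chains_def relation_of_def)
    show "\<exists>u\<in>A. \<forall>a\<in>C. u \<le> a"
    proof (cases "C = {}")
      case True
      then show ?thesis using p by (auto simp: A_def)
    next
      case False
      \<comment> \<open>The pointwise infimum bounds the chain from below. It is finite because
        every member satisfies \<open>q x \<ge> - q (- x) \<ge> - p (- x)\<close>.\<close>
      define u where "u = (\<lambda>x. INF q\<in>C. q x)"
      have "- p (- x) \<le> q x" if "q \<in> C" for q x
      proof -
        have "sublinear q" "q (- x) \<le> p (- x)" using that C by (auto simp: A_def le_fun_def)
        then show ?thesis using sublinear_minus[of q x] by simp
      qed
      then have bdd: "bdd_below ((\<lambda>q. q x) ` C)" for x by (auto intro!: bdd_belowI2)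
      have u_le: "u x \<le> q x" if "q \<in> C" for q x
        unfolding u_def using that by (intro cINF_lower bdd)
      have u_ge: "v \<le> u x" if "\<And>q. q \<in> C \<Longrightarrow> v \<le> q x" for v x
        unfolding u_def using that False by (intro cINF_greatest) auto
      have "sublinear u"
        unfolding sublinear_def
      proof (intro conjI allI impI)
        fix x y
        have "u (x + y) - u y \<le> u x"
        proof (rule u_ge)
          fix q1 assume q1: "q1 \<in> C"
          have "u (x + y) - q1 x \<le> u y"
          proof (rule u_ge)
            fix q2 assume q2: "q2 \<in> C"
            \<comment> \<open>An infimum of sublinear functions need not be subadditive; in a chain,
              the smaller of \<open>q1\<close> and \<open>q2\<close> serves for both
              summands.\<close>
            obtain q where "q \<in> C" "q \<le> q1" "q \<le> q2" using chain[OF q1 q2] q1 q2 by blast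
            moreover from this have "q (x + y) \<le> q x + q y"
              using C sublinear_add[of q] by (auto simp: A_def)
            ultimately show "u (x + y) - q1 x \<le> q2 y"
              using u_le[of q "x + y"] le_funD[of q q1 x] le_funD[of q q2 y] by linarith
          qed
          then show "u (x + y) - u y \<le> q1 x" by simp
        qed
        then show "u (x + y) \<le> u x + u y" by simp
      next
        fix c :: real and x assume c: "c > 0"
        have "u (c *\<^sub>R x) / c \<le> u x"
        proof (rule u_ge)
          fix q assume q: "q \<in> C"
          then have "q (c *\<^sub>R x) = c * q x"
            using C sublinear_scale[of q c x] c by (auto simp: A_def)
          then show "u (c *\<^sub>R x) / c \<le> q x" using u_le[OF q, of "c *\<^sub>R x"] c by (simp add: field_simps)
        qed
        then show "u (c *\<^sub>R x) \<le> c * u x" using c by (simp add: field_simps)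
      qed
      moreover have "u \<le> p"
      proof -
        obtain q where q: "q \<in> C" using False by blast
        then have "q \<le> p" using C by (auto simp: A_def)
        with u_le[OF q] show ?thesis by (force simp: le_fun_def intro: order_trans)
      qed
      ultimately show ?thesis using u_le by (auto simp: A_def le_fun_def)
    qed
  qed
  then obtain m where m: "sublinear m" "m \<le> p" "\<And>a. sublinear a \<Longrightarrow> a \<le> m \<Longrightarrow> a = m"
    unfolding A_def by (blast intro: order_trans)
  show ?thesis
    by (rule that[OF minimal_sublinear_imp_linear]) (use m in auto)
qed

text \<open>The norm is first lowered along \<open>x\<close>, to \<open>q\<close> with
  \<open>q (- x) \<le> - norm x\<close>. Every linear minorant of \<open>q\<close> then takes the
  value \<open>norm x\<close> at \<open>x\<close>, and being below the norm on \<open>y\<close> and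
  on \<open>- y\<close> bounds its absolute value.\<close>

lemma norming_functional:
  fixes x :: "'e::real_normed_vector"
  obtains \<phi> :: "'e \<Rightarrow> real" where "bounded_linear \<phi>" "\<phi> x = norm x" "\<And>y. \<bar>\<phi> y\<bar> \<le> norm y"
proof -
  have "sublinear (norm :: 'e \<Rightarrow> real)" by (simp add: sublinear_def norm_triangle_ineq)
  then obtain q :: "'e \<Rightarrow> real" where q: "sublinear q" "q \<le> norm" "q (- x) \<le> - norm x"
    by (rule sublinear_shift)
  obtain l where l: "linear l" "l \<le> q" using sublinear_dominates_linear[OF q(1)] .
  have le: "l y \<le> norm y" for y using l(2) q(2) by (force simp: le_fun_def intro: order_trans)
  have abs: "\<bar>l y\<bar> \<le> norm y" for y
    using le[of y] le[of "- y"] linear_neg[OF l(1), of y] by simp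
  have "l (- x) \<le> - norm x" using l(2) q(3) by (force simp: le_fun_def intro: order_trans)
  then have "l x = norm x" using le[of x] linear_neg[OF l(1), of x] by simp
  moreover have "bounded_linear l"
    using l(1) abs by (auto intro!: bounded_linear_intro[where K = 1] simp: linear_add linear_scale)
  ultimately show ?thesis using abs that by blast
qed

text \<open>Norming functionals of a countable dense set suffice. If all of them vanish at
  \<open>x\<close> and \<open>d\<close> is within \<open>norm x / 2\<close> of \<open>x\<close>,
  then the functional of \<open>d\<close> gives
  \<open>norm d \<le> norm (d - x) < norm x / 2\<close>, which contradicts the triangle
  inequality.\<close>

lemma countable_separating_functionals:
  obtains \<phi> :: "nat \<Rightarrow> 'e::{real_normed_vector,second_countable_topology} \<Rightarrow> real"
  where "\<And>n. bounded_linear (\<phi> n)" "\<And>x. (\<And>n. \<phi> n x = 0) \<Longrightarrow> x = 0"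
proof -
  obtain D :: "'e set" where D: "countable D" "\<And>X. open X \<Longrightarrow> X \<noteq> {} \<Longrightarrow> \<exists>d\<in>D. d \<in> X"
    using countable_dense_exists by blast
  have "D \<noteq> {}" using D(2)[of UNIV] by auto
  define \<psi> :: "'e \<Rightarrow> 'e \<Rightarrow> real" where
    "\<psi> = (\<lambda>x. SOME \<phi>. bounded_linear \<phi> \<and> \<phi> x = norm x \<and> (\<forall>y. \<bar>\<phi> y\<bar> \<le> norm y))"
  have *: "bounded_linear (\<psi> x) \<and> \<psi> x x = norm x \<and> (\<forall>y. \<bar>\<psi> x y\<bar> \<le> norm y)" for x
  proof -
    have "\<exists>\<phi>. bounded_linear \<phi> \<and> \<phi> x = norm x \<and> (\<forall>y. \<bar>\<phi> y\<bar> \<le> norm y)"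
      using norming_functional[of x] by metis
    then show ?thesis unfolding \<psi>_def by (rule someI_ex)
  qed
  then have \<psi>: "bounded_linear (\<psi> x)" "\<psi> x x = norm x" "\<bar>\<psi> x y\<bar> \<le> norm y" for x y
    by blast+
  show ?thesis
  proof (rule that[of "\<lambda>n. \<psi> (from_nat_into D n)"])
    fix x assume 0: "\<And>n. \<psi> (from_nat_into D n) x = 0"
    show "x = 0"
    proof (rule ccontr)
      assume "x \<noteq> 0"
      then have "ball x (norm x / 2) \<noteq> {}" by simp
      then obtain d where d: "d \<in> D" "dist x d < norm x / 2"
        using D(2)[of "ball x (norm x / 2)"] by auto
      then obtain n where "d = from_nat_into D n"
        using from_nat_into_surj[OF D(1)] by metis
      then have "\<psi> d x = 0" using 0 by simp
      then have "norm d \<le> norm (d - x)"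
        using \<psi>(2)[of d] \<psi>(3)[of d "d - x"] bounded_linear.linear[OF \<psi>(1)[of d]]
        by (simp add: linear_diff)
      then show False
        using d(2) norm_triangle_ineq2[of x d] by (simp add: dist_norm norm_minus_commute)
    qed
  qed (rule \<psi>)
qed

section \<open>Real densities of vector measures\<close>

lemma vector_measure_sums:
  assumes "vector_measure M m" "\<And>i. A i \<in> sets M" "disjoint_family A"
  shows "(\<lambda>i::nat. m (A i)) sums m (\<Union>i. A i)"
  using assms by (auto simp: vector_measure_def)

lemma vector_measure_empty:
  assumes "vector_measure M m"
  shows "m {} = 0"
proof -
  have "(\<lambda>i::nat. m {}) sums m (\<Union>i::nat. {})"
    by (rule vector_measure_sums[OF assms]) (auto simp: disjoint_family_on_def)
  then have "(\<lambda>i::nat. m {}) \<longlonglongrightarrow> 0"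
    by (intro summable_LIMSEQ_zero sums_summable)
  then show ?thesis by (simp add: LIMSEQ_const_iff)
qed

lemma vector_measure_Un:
  assumes m: "vector_measure M m" and "A \<in> sets M" "B \<in> sets M" "A \<inter> B = {}"
  shows "m (A \<union> B) = m A + m B"
proof -
  have *: "(\<lambda>i. m (binaryset A B i)) sums m (\<Union>i. binaryset A B i)"
    by (rule vector_measure_sums[OF m])
       (use assms in \<open>auto simp: binaryset_def disjoint_family_on_def\<close>)
  show ?thesis
    using sums_unique2[OF * binaryset_sums[of m, OF vector_measure_empty[OF m]]] by (simp add: UN_binaryset_eq)
qed

lemma vector_measure_Diff:
  assumes m: "vector_measure M m" and "A \<in> sets M" "B \<in> sets M" "B \<subseteq> A"
  shows "m (A - B) = m A - m B"
  using vector_measure_Un[OF m, of "A - B" B] assms by (simp add: Un_absorb2 Diff_Int_distrib2)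

lemma vector_measure_compose:
  assumes "vector_measure M m" "bounded_linear \<phi>"
  shows "vector_measure M (\<lambda>A. \<phi> (m A))"
  using assms by (auto simp: vector_measure_def intro: bounded_linear.sums)

text \<open>Call a set bad if \<open>m\<close> is unbounded on its measurable subsets. A bad set
  contains a bad set whose complement in it has a value of norm at least 1. Iteration produces
  disjoint differences whose values do not tend to 0, against countable additivity.\<close>

lemma vector_measure_bounded:
  assumes m: "vector_measure M m"
  obtains C where "\<And>A. A \<in> sets M \<Longrightarrow> norm (m A) \<le> C"
proof (rule ccontr)
  assume "\<not> thesis"
  with that have unbdd: "\<exists>A\<in>sets M. norm (m A) > C" for C by (meson not_le)
  define bad where "bad A \<longleftrightarrow> A \<in> sets M \<and> (\<forall>C. \<exists>B\<in>sets M. B \<subseteq> A \<and> norm (m B) > C)" for A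
  have step: "\<exists>A'. bad A' \<and> A' \<subseteq> A \<and> norm (m (A - A')) \<ge> 1" if A: "bad A" for A
  proof -
    have [measurable]: "A \<in> sets M" using A by (simp add: bad_def)
    \<comment> \<open>The margin \<open>norm (m A) + 1\<close> makes both \<open>m B\<close> and
      \<open>m (A - B)\<close> have norm at least 1, so either half may be the one that is
      discarded.\<close>
    obtain B where B[measurable]: "B \<in> sets M" and "B \<subseteq> A" "norm (m B) > norm (m A) + 1"
      using A unfolding bad_def by blast
    have "norm (m (A - B)) \<ge> 1"
      using vector_measure_Diff[OF m, of A B] B \<open>B \<subseteq> A\<close> \<open>norm (m B) > norm (m A) + 1\<close>
        norm_triangle_ineq2[of "m B" "m A"] by (simp add: norm_minus_commute)
    moreover have "norm (m (A - (A - B))) \<ge> 1"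
    proof -
      have "A - (A - B) = B" using \<open>B \<subseteq> A\<close> by blast
      then show ?thesis using \<open>norm (m B) > norm (m A) + 1\<close> norm_ge_zero[of "m A"]
        by (simp add: less_imp_le order_trans[of 1 "norm (m A) + 1"])
    qed
    \<comment> \<open>If \<open>m\<close> were bounded by \<open>C1\<close> on one half and by
      \<open>C2\<close> on the other, it would be bounded by \<open>C1 + C2\<close> on the subsets
      of \<open>A\<close>.\<close>
    moreover have "bad B \<or> bad (A - B)"
    proof (rule ccontr)
      assume "\<not> (bad B \<or> bad (A - B))"
      then have "\<exists>C1. \<forall>D\<in>sets M. D \<subseteq> B \<longrightarrow> norm (m D) \<le> C1"
        and "\<exists>C2. \<forall>D\<in>sets M. D \<subseteq> A - B \<longrightarrow> norm (m D) \<le> C2"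
        using B unfolding bad_def by (auto simp: not_less)
      then obtain C1 C2 where C1: "\<forall>D\<in>sets M. D \<subseteq> B \<longrightarrow> norm (m D) \<le> C1"
        and C2: "\<forall>D\<in>sets M. D \<subseteq> A - B \<longrightarrow> norm (m D) \<le> C2"
        by (elim exE)
      obtain D where D[measurable]: "D \<in> sets M" and "D \<subseteq> A" "norm (m D) > C1 + C2"
        using A unfolding bad_def by (elim conjE allE[of _ "C1 + C2"] bexE)
      have "m D = m ((D \<inter> B) \<union> (D - B))" by (rule arg_cong[where f = m]) blast
      also have "\<dots> = m (D \<inter> B) + m (D - B)"
        by (rule vector_measure_Un[OF m]) auto
      finally have "m D = m (D \<inter> B) + m (D - B)" .
      moreover have "norm (m (D \<inter> B)) \<le> C1" "norm (m (D - B)) \<le> C2"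
        using C1[rule_format, of "D \<inter> B"] C2[rule_format, of "D - B"] \<open>D \<subseteq> A\<close>
        by (simp_all add: Diff_mono)
      ultimately show False
        using \<open>norm (m D) > C1 + C2\<close> norm_triangle_ineq[of "m (D \<inter> B)" "m (D - B)"] by simp
    qed
    ultimately show ?thesis using \<open>B \<subseteq> A\<close> by blast
  qed
  have "\<exists>B\<in>sets M. B \<subseteq> space M \<and> norm (m B) > C" for C
    using unbdd[of C] sets.sets_into_space by (elim bexE) auto
  then have "bad (space M)" by (simp add: bad_def)
  have "\<exists>f. \<forall>n. bad (f n) \<and> f (Suc n) \<subseteq> f n \<and> norm (m (f n - f (Suc n))) \<ge> 1"
    by (rule dependent_nat_choice[where P = "\<lambda>_. bad"]) (use step \<open>bad (space M)\<close> in auto)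
  then obtain f where f: "\<And>n. bad (f n)" "\<And>n. f (Suc n) \<subseteq> f n" "\<And>n. norm (m (f n - f (Suc n))) \<ge> 1"
    by auto
  have "decseq f" using f(2) by (rule decseq_SucI)
  have "disjoint_family (\<lambda>n. f n - f (Suc n))"
    unfolding disjoint_family_on_def
  proof (intro ballI impI)
    fix i j :: nat assume "i \<noteq> j"
    then show "(f i - f (Suc i)) \<inter> (f j - f (Suc j)) = {}"
      using decseqD[OF \<open>decseq f\<close>, of "Suc i" j] decseqD[OF \<open>decseq f\<close>, of "Suc j" i]
      by (cases i j rule: linorder_cases) auto
  qed
  moreover have "f n - f (Suc n) \<in> sets M" for n using f(1) by (auto simp: bad_def)
  ultimately have "(\<lambda>n. m (f n - f (Suc n))) sums m (\<Union>n. f n - f (Suc n))"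
    by (intro vector_measure_sums[OF m]) auto
  then have "(\<lambda>n. m (f n - f (Suc n))) \<longlonglongrightarrow> 0"
    by (intro summable_LIMSEQ_zero sums_summable)
  then have "eventually (\<lambda>n. norm (m (f n - f (Suc n))) < 1) sequentially"
    by (auto dest: tendstoD[of _ _ _ 1] simp: dist_norm)
  then obtain n where "norm (m (f n - f (Suc n))) < 1" by (auto simp: eventually_sequentially)
  with f(3)[of n] show False by simp
qed

text \<open>Turning \<open>p\<close> into a measure \<open>N\<close> makes the Radon-Nikodym theorem
  applicable. As \<open>p (space M)\<close> is a real number, the density is finite almost
  everywhere, so passing to \<open>enn2real\<close> changes no integral.\<close>

lemma nonneg_vector_measure_density:
  fixes p :: "'a set \<Rightarrow> real"
  assumes "finite_measure M" and p: "vector_measure M p" "mu_continuous M p"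
    and nonneg: "\<And>A. A \<in> sets M \<Longrightarrow> p A \<ge> 0"
  obtains h where "integrable M h" "\<And>A. A \<in> sets M \<Longrightarrow> p A = (\<integral>x. indicator A x * h x \<partial>M)"
proof -
  interpret finite_measure M by fact
  define N where "N = measure_of (space M) (sets M) (\<lambda>A. ennreal (p A))"
  have sets_N [measurable_cong, simp]: "sets N = sets M" and [simp]: "space N = space M"
    by (auto simp: N_def)
  have emeasure_N: "emeasure N A = ennreal (p A)" if "A \<in> sets M" for A
    unfolding N_def
  proof (rule emeasure_measure_of_sigma)
    show "positive (sets M) (\<lambda>A. ennreal (p A))"
      by (simp add: positive_def vector_measure_empty[OF p(1)])
    show "countably_additive (sets M) (\<lambda>A. ennreal (p A))"
      unfolding countably_additive_def
    proof (intro allI impI)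
      fix A :: "nat \<Rightarrow> 'a set" assume A: "range A \<subseteq> sets M" "disjoint_family A"
      then have "(\<lambda>i. p (A i)) sums p (\<Union>i. A i)"
        by (intro vector_measure_sums[OF p(1)]) auto
      then show "(\<Sum>i. ennreal (p (A i))) = ennreal (p (\<Union>i. A i))"
        using A nonneg by (subst suminf_ennreal2) (auto simp: sums_iff)
    qed
  qed (use that sets.sigma_algebra_axioms in auto)
  have "absolutely_continuous M N"
    using p(2) emeasure_N unfolding absolutely_continuous_def mu_continuous_def by (auto simp: null_sets_def)
  then obtain g where g [measurable]: "g \<in> borel_measurable M" and N: "density M g = N"
    using Radon_Nikodym[of N] by auto
  have int_g: "(\<integral>\<^sup>+x. g x * indicator A x \<partial>M) = ennreal (p A)" if "A \<in> sets M" for A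
    using emeasure_density[OF g that] emeasure_N[OF that] N by simp
  have "(\<integral>\<^sup>+x. g x \<partial>M) = (\<integral>\<^sup>+x. g x * indicator (space M) x \<partial>M)"
    by (intro nn_integral_cong) simp
  then have "(\<integral>\<^sup>+x. g x \<partial>M) \<noteq> \<infinity>"
    using int_g[of "space M"] by simp
  then have fin: "AE x in M. g x \<noteq> \<infinity>" by (intro nn_integral_PInf_AE) auto
  show ?thesis
  proof (rule that[of "\<lambda>x. enn2real (g x)"])
    have eq: "(\<integral>\<^sup>+x. ennreal (indicator A x * enn2real (g x)) \<partial>M) = (\<integral>\<^sup>+x. g x * indicator A x \<partial>M)" for A
      using fin by (intro nn_integral_cong_AE, eventually_elim) (auto simp: indicator_def ennreal_enn2real_if)
    show "integrable M (\<lambda>x. enn2real (g x))"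
      using eq[of UNIV] \<open>(\<integral>\<^sup>+x. g x \<partial>M) \<noteq> \<infinity>\<close> by (intro integrableI_bounded) (auto simp: top.not_eq_extremum)
    fix A assume [measurable]: "A \<in> sets M"
    show "p A = (\<integral>x. indicator A x * enn2real (g x) \<partial>M)"
      using eq[of A] int_g[of A] nonneg by (subst integral_eq_nn_integral) auto
  qed
qed

text \<open>This is the positive part of the Jordan decomposition, the supremum of
  \<open>\<nu>\<close> over measurable subsets. It is finite because \<open>\<nu>\<close> is
  bounded. The last conclusion serves to carry \<open>mu_continuous\<close> over to
  \<open>p\<close>.\<close>

lemma positive_variation:
  fixes \<nu> :: "'a set \<Rightarrow> real"
  assumes \<nu>: "vector_measure M \<nu>"
  obtains p where "vector_measure M p" "\<And>A. A \<in> sets M \<Longrightarrow> p A \<ge> 0" "\<And>A. A \<in> sets M \<Longrightarrow> \<nu> A \<le> p A"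
    "\<And>A. A \<in> sets M \<Longrightarrow> (\<And>B. B \<in> sets M \<Longrightarrow> B \<subseteq> A \<Longrightarrow> \<nu> B = 0) \<Longrightarrow> p A = 0"
proof -
  obtain C where C: "\<And>A. A \<in> sets M \<Longrightarrow> norm (\<nu> A) \<le> C" using vector_measure_bounded[OF \<nu>] by blast
  define p where "p A = (SUP B\<in>{B\<in>sets M. B \<subseteq> A}. \<nu> B)" for A
  have bdd: "bdd_above (\<nu> ` {B\<in>sets M. B \<subseteq> A})" for A
    using C by (auto intro!: bdd_aboveI2[where M = C] dest: abs_le_D1)
  have p_ge: "\<nu> B \<le> p A" if "B \<in> sets M" "B \<subseteq> A" for A B
    unfolding p_def using that by (intro cSUP_upper bdd) auto
  have p_le: "p A \<le> u" if "\<And>B. B \<in> sets M \<Longrightarrow> B \<subseteq> A \<Longrightarrow> \<nu> B \<le> u" for A u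
    unfolding p_def using that by (intro cSUP_least) auto
  have p_nonneg: "p A \<ge> 0" for A
    using p_ge[of "{}" A] vector_measure_empty[OF \<nu>] by simp
  have p_mono: "p A \<le> p B" if "A \<subseteq> B" for A B
    by (rule p_le) (use that p_ge in blast)
  \<comment> \<open>Superadditivity on disjoint sets gives one half of countable additivity; the
    other half comes from cutting a competitor \<open>B\<close> into the pieces
    \<open>B \<inter> A i\<close>.\<close>
  have p_super: "p A + p B \<le> p (A \<union> B)" if "A \<inter> B = {}" for A B
  proof -
    have "p A \<le> p (A \<union> B) - p B"
    proof (rule p_le)
      fix D assume D: "D \<in> sets M" "D \<subseteq> A"
      have "p B \<le> p (A \<union> B) - \<nu> D"
      proof (rule p_le)
        fix D' assume D': "D' \<in> sets M" "D' \<subseteq> B"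
        have "\<nu> (D \<union> D') = \<nu> D + \<nu> D'"
          by (rule vector_measure_Un[OF \<nu>]) (use D D' that in auto)
        moreover have "\<nu> (D \<union> D') \<le> p (A \<union> B)" by (rule p_ge) (use D D' in auto)
        ultimately show "\<nu> D' \<le> p (A \<union> B) - \<nu> D" by simp
      qed
      then show "\<nu> D \<le> p (A \<union> B) - p B" by simp
    qed
    then show ?thesis by simp
  qed
  have "vector_measure M p"
    unfolding vector_measure_def
  proof (intro allI impI)
    fix A :: "nat \<Rightarrow> 'a set" assume A: "range A \<subseteq> sets M" and disj: "disjoint_family A"
    have partial: "(\<Sum>i<n. p (A i)) \<le> p (\<Union>i<n. A i)" for n
    proof (induction n)
      case (Suc n)
      have "A i \<inter> A n = {}" if "i < n" for i
        using disj that by (intro disjoint_family_onD) auto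
      then have "(\<Union>i<n. A i) \<inter> A n = {}" by blast
      from p_super[OF this] Suc show ?case by (simp add: lessThan_Suc Un_commute add.commute)
    qed (use p_nonneg in simp)
    then have partial': "(\<Sum>i<n. p (A i)) \<le> p (\<Union>i. A i)" for n
      by (rule order_trans) (rule p_mono, blast)
    have summ: "summable (\<lambda>i. p (A i))"
      by (rule bounded_imp_summable[OF p_nonneg, of _ "p (\<Union>i. A i)"])
         (metis lessThan_Suc_atMost partial')
    have "p (\<Union>i. A i) \<le> (\<Sum>i. p (A i))"
    proof (rule p_le)
      fix B assume B: "B \<in> sets M" "B \<subseteq> (\<Union>i. A i)"
      have "(\<lambda>i. \<nu> (B \<inter> A i)) sums \<nu> (\<Union>i. B \<inter> A i)"
        by (rule vector_measure_sums[OF \<nu>])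
           (use A B in \<open>auto intro: disjoint_family_subset[OF disj]\<close>)
      moreover have "(\<Union>i. B \<inter> A i) = B" using B by blast
      ultimately have s: "(\<lambda>i. \<nu> (B \<inter> A i)) sums \<nu> B" by simp
      show "\<nu> B \<le> (\<Sum>i. p (A i))"
        by (rule sums_le[OF _ s summable_sums[OF summ]]) (use A B p_ge in auto)
    qed
    moreover have "(\<Sum>i. p (A i)) \<le> p (\<Union>i. A i)"
      by (rule suminf_le_const[OF summ]) (rule partial')
    ultimately show "(\<lambda>i. p (A i)) sums p (\<Union>i. A i)"
      using summ by (simp add: sums_iff)
  qed
  moreover have "p A = 0" if "\<And>B. B \<in> sets M \<Longrightarrow> B \<subseteq> A \<Longrightarrow> \<nu> B = 0" for A
    using p_le[of A 0] p_nonneg[of A] that by force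
  ultimately show ?thesis using that[of p] p_nonneg p_ge by auto
qed

text \<open>Jordan decomposition: \<open>\<nu>\<close> is the difference of the nonnegative measures
  \<open>p\<close> and \<open>q\<close>, and each of them has a density.\<close>

lemma vector_measure_density:
  fixes \<nu> :: "'a set \<Rightarrow> real"
  assumes fin: "finite_measure M" and \<nu>: "vector_measure M \<nu>" "mu_continuous M \<nu>"
  obtains h where "integrable M h" "\<And>A. A \<in> sets M \<Longrightarrow> \<nu> A = (\<integral>x. indicator A x * h x \<partial>M)"
proof -
  obtain p where p: "vector_measure M p" "\<And>A. A \<in> sets M \<Longrightarrow> p A \<ge> 0" "\<And>A. A \<in> sets M \<Longrightarrow> \<nu> A \<le> p A"
    "\<And>A. A \<in> sets M \<Longrightarrow> (\<And>B. B \<in> sets M \<Longrightarrow> B \<subseteq> A \<Longrightarrow> \<nu> B = 0) \<Longrightarrow> p A = 0"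
    by (rule positive_variation[OF \<nu>(1)]) blast
  have "\<nu> B = 0" if "A \<in> sets M" "emeasure M A = 0" "B \<in> sets M" "B \<subseteq> A" for A B
  proof -
    have "emeasure M B = 0" using emeasure_mono[OF that(4,1)] that(2) by simp
    then show ?thesis using \<nu>(2) that(3) by (simp add: mu_continuous_def)
  qed
  then have p0: "mu_continuous M p"
    unfolding mu_continuous_def by (intro ballI impI p(4)) auto
  define q where "q A = p A - \<nu> A" for A
  have q: "vector_measure M q" "mu_continuous M q" "\<And>A. A \<in> sets M \<Longrightarrow> q A \<ge> 0"
    using p(1,3) \<nu> p0 by (auto simp: vector_measure_def q_def mu_continuous_def intro!: sums_diff)
  obtain h where h: "integrable M h" "\<And>A. A \<in> sets M \<Longrightarrow> p A = (\<integral>x. indicator A x * h x \<partial>M)"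
    using nonneg_vector_measure_density[OF fin p(1) p0 p(2)] by auto
  obtain k where k: "integrable M k" "\<And>A. A \<in> sets M \<Longrightarrow> q A = (\<integral>x. indicator A x * k x \<partial>M)"
    using nonneg_vector_measure_density[OF fin q] by auto
  show ?thesis
  proof (rule that[of "\<lambda>x. h x - k x"])
    fix A assume A: "A \<in> sets M"
    have "integrable M (\<lambda>x. indicator A x * h x)" "integrable M (\<lambda>x. indicator A x * k x)"
      using integrable_mult_indicator[OF A h(1)] integrable_mult_indicator[OF A k(1)] by simp_all
    then have "(\<integral>x. indicator A x * (h x - k x) \<partial>M) = p A - q A"
      using h(2)[OF A] k(2)[OF A] by (simp add: right_diff_distrib)
    then show "\<nu> A = (\<integral>x. indicator A x * (h x - k x) \<partial>M)" by (simp add: q_def)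
  qed (use h k in auto)
qed

section \<open>Closed subspaces of \<open>L\<^sup>1\<close> and separability\<close>

text \<open>A predicate on functions instead of a set of classes, so that approximability and weak
  convergence can be inserted directly. Invariance under almost everywhere equality follows from
  closure under limits.\<close>

definition closed_L1_subspace :: "'a measure \<Rightarrow> (('a \<Rightarrow> real) \<Rightarrow> bool) \<Rightarrow> bool" where
  "closed_L1_subspace M P \<longleftrightarrow>
    (\<forall>f g. integrable M f \<longrightarrow> integrable M g \<longrightarrow> P f \<longrightarrow> P g \<longrightarrow> P (\<lambda>x. f x + g x)) \<and>
    (\<forall>c f. integrable M f \<longrightarrow> P f \<longrightarrow> P (\<lambda>x. c * f x)) \<and>
    (\<forall>s f. (\<forall>n::nat. integrable M (s n) \<and> P (s n)) \<longrightarrow> integrable M f \<longrightarrow>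
       (\<lambda>n. \<integral>x. \<bar>s n x - f x\<bar> \<partial>M) \<longlonglongrightarrow> 0 \<longrightarrow> P f)"

lemma closed_L1_subspaceD:
  assumes "closed_L1_subspace M P"
  shows closed_L1_add: "integrable M f \<Longrightarrow> integrable M g \<Longrightarrow> P f \<Longrightarrow> P g \<Longrightarrow> P (\<lambda>x. f x + g x)"
    and closed_L1_scale: "integrable M f \<Longrightarrow> P f \<Longrightarrow> P (\<lambda>x. c * f x)"
    and closed_L1_lim: "(\<And>n::nat. integrable M (s n)) \<Longrightarrow> (\<And>n. P (s n)) \<Longrightarrow> integrable M f \<Longrightarrow>
       (\<lambda>n. \<integral>x. \<bar>s n x - f x\<bar> \<partial>M) \<longlonglongrightarrow> 0 \<Longrightarrow> P f"
  using assms unfolding closed_L1_subspace_def by blast+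

lemma closed_L1_AE:
  assumes P: "closed_L1_subspace M P" and f: "integrable M f" "P f" and g: "integrable M g"
    and "AE x in M. f x = g x"
  shows "P g"
proof (rule closed_L1_lim[OF P])
  have "(\<integral>x. \<bar>f x - g x\<bar> \<partial>M) = (\<integral>x. 0 \<partial>M)"
    by (rule integral_cong_AE) (use assms in auto)
  then show "(\<lambda>n. \<integral>x. \<bar>f x - g x\<bar> \<partial>M) \<longlonglongrightarrow> 0" by simp
qed (use f g in auto)

lemma dominated_convergence_L1:
  fixes f :: "'a \<Rightarrow> real"
  assumes [measurable]: "\<And>n. s n \<in> borel_measurable M" "f \<in> borel_measurable M"
    and w: "integrable M w" and bound: "\<And>n x. x \<in> space M \<Longrightarrow> \<bar>s n x\<bar> \<le> w x"
    and lim: "AE x in M. (\<lambda>n. s n x) \<longlonglongrightarrow> f x"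
  shows "(\<lambda>n. \<integral>x. \<bar>s n x - f x\<bar> \<partial>M) \<longlonglongrightarrow> 0"
proof -
  have "(\<lambda>n. \<integral>x. \<bar>s n x - f x\<bar> \<partial>M) \<longlonglongrightarrow> (\<integral>x. 0 \<partial>M)"
  proof (rule integral_dominated_convergence[where w = "\<lambda>x. 2 * w x"])
    show "AE x in M. (\<lambda>n. \<bar>s n x - f x\<bar>) \<longlonglongrightarrow> 0"
      using lim by eventually_elim (rule tendsto_rabs_zero, rule LIM_zero)
    show "AE x in M. norm \<bar>s n x - f x\<bar> \<le> 2 * w x" for n
      using lim AE_space
    proof eventually_elim
      case (elim x)
      have "\<bar>f x\<bar> \<le> w x"
        by (rule LIMSEQ_le_const2[OF tendsto_rabs[OF elim(1)]]) (use bound elim in auto)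
      then show ?case using bound[OF elim(2), of n] by simp
    qed
  qed (use w in auto)
  then show ?thesis by simp
qed

text \<open>The sets whose indicators satisfy \<open>P\<close> form a Dynkin system, so they include
  the \<sigma>-algebra generated by the intersection-stable \<open>\<A>\<close>. Linear combinations
  and dominated limits then reach every integrable function measurable for it.\<close>

lemma closed_L1_induct:
  assumes "finite_measure M" and P: "closed_L1_subspace M P"
    and \<A>: "Int_stable \<A>" "\<A> \<subseteq> sets M" "space M \<in> \<A>"
    and ind: "\<And>A. A \<in> \<A> \<Longrightarrow> P (indicator A)"
    and f: "integrable M f" "f \<in> borel_measurable (sigma (space M) \<A>)"
  shows "P f"
proof -
  interpret finite_measure M by fact
  define D where "D = sigma (space M) \<A>"
  have Pow: "\<A> \<subseteq> Pow (space M)" using \<A>(2) sets.space_closed by blast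
  have sets_D: "sets D = sigma_sets (space M) \<A>" and space_D: "space D = space M"
    using Pow by (auto simp: D_def)
  have sub: "subalgebra M D"
    unfolding subalgebra_def sets_D space_D using \<A>(2) by (auto intro: sets.sigma_sets_subset[THEN subsetD])
  have DM: "sets D \<subseteq> sets M" using sub by (simp add: subalgebra_def)
  have int_M: "integrable M (indicator A :: 'a \<Rightarrow> real)" if "A \<in> sets M" for A
    using that by (intro integrable_real_indicator) (auto simp: less_top[symmetric])
  then have int: "integrable M (indicator A :: 'a \<Rightarrow> real)" if "A \<in> sets D" for A
    using DM that by auto
  have P_ind: "P (indicator B)" if "B \<in> sigma_sets (space M) \<A>" for B
    using \<A>(1) Pow that
  proof (induction rule: sigma_sets_induct_disjoint)
    case (basic A)
    then show ?case by (rule ind)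
  next
    case empty
    have "P (\<lambda>x. 0 * indicator (space M) x)"
      by (rule closed_L1_scale[OF P int_M[OF sets.top] ind[OF \<A>(3)]])
    then show ?case by (simp add: indicator_def[abs_def])
  next
    case (compl A)
    have A: "A \<in> sets D" "space M \<in> sets D" using compl \<A>(3) by (auto simp: sets_D)
    have "P (\<lambda>x. indicator (space M) x + (- 1) * indicator A x)"
      by (intro closed_L1_add[OF P] closed_L1_scale[OF P] ind[OF \<A>(3)] compl int A integrable_mult_right)
    moreover have "(\<lambda>x. indicator (space M) x + (- 1) * indicator A x) = (indicator (space M - A) :: 'a \<Rightarrow> real)"
      using sets.sets_into_space[OF A(1)] by (auto simp: space_D indicator_def fun_eq_iff)
    ultimately show ?case by simp
  next
    case (union A)
    have A: "A i \<in> sets D" for i using union by (auto simp: sets_D)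
    then have [measurable]: "A i \<in> sets M" for i using DM by auto
    have UnP: "P (indicator (\<Union>i<n. A i))" for n
    proof (induction n)
      case 0
      have "P (\<lambda>x. 0 * indicator (space M) x)"
        by (rule closed_L1_scale[OF P int_M[OF sets.top] ind[OF \<A>(3)]])
      then show ?case by (simp add: indicator_def[abs_def])
    next
      case (Suc n)
      have "P (\<lambda>x. indicator (\<Union>i<n. A i) x + indicator (A n) x)"
        by (intro closed_L1_add[OF P] Suc union int_M) auto
      moreover have "A i \<inter> A n = {}" if "i < n" for i
        using union that by (intro disjoint_family_onD) auto
      then have "(\<lambda>x. indicator (\<Union>i<n. A i) x + indicator (A n) x) = (indicator (\<Union>i<Suc n. A i) :: 'a \<Rightarrow> real)"
        by (subst indicator_add) (auto simp: lessThan_Suc Un_commute)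
      ultimately show ?case by simp
    qed
    show ?case
    proof (rule closed_L1_lim[OF P, of "\<lambda>n. indicator (\<Union>i<n. A i)"])
      show "(\<lambda>n. \<integral>x. \<bar>indicator (\<Union>i<n. A i) x - indicator (\<Union>i. A i) x\<bar> \<partial>M) \<longlonglongrightarrow> (0::real)"
      proof (rule dominated_convergence_L1[where w = "\<lambda>_. 1"])
        show "AE x in M. (\<lambda>n. indicator (\<Union>i<n. A i) x) \<longlonglongrightarrow> (indicator (\<Union>i. A i) x :: real)"
          by (intro AE_I2 LIMSEQ_indicator_UN)
      qed (auto simp: indicator_def)
    qed (auto intro: UnP int_M)
  qed
  \<comment> \<open>The induction runs over the restricted measure, so that all approximating simple
    functions are built from sets of \<open>D\<close>.\<close>
  have "integrable (restr_to_subalg M D) f"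
    using f by (intro integrable_in_subalg[OF sub]) (auto simp: D_def)
  then show "P f"
  proof (induction rule: integrable_induct)
    case (base A c)
    then have A: "A \<in> sets D" by (simp add: sets_restr_to_subalg[OF sub])
    then have "P (\<lambda>x. c * indicator A x)"
      using P_ind int by (intro closed_L1_scale[OF P]) (auto simp: sets_D)
    then show ?case by (simp add: mult.commute)
  next
    case (add f g)
    then show ?case
      by (intro closed_L1_add[OF P] integrable_from_subalg[OF sub]) auto
  next
    case (lim f s)
    have int: "integrable M f" "integrable M (s n)" for n
      using lim by (auto intro: integrable_from_subalg[OF sub])
    show ?case
    proof (rule closed_L1_lim[OF P int(2) lim.IH int(1)])
      show "(\<lambda>n. \<integral>x. \<bar>s n x - f x\<bar> \<partial>M) \<longlonglongrightarrow> 0"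
        by (rule dominated_convergence_L1[where w = "\<lambda>x. 2 * \<bar>f x\<bar>"])
           (use int lim in \<open>auto simp: space_restr_to_subalg\<close>)
    qed
  qed
qed

lemma closed_L1_induct_sets:
  assumes "finite_measure M" "closed_L1_subspace M P"
    and "\<And>A. A \<in> sets M \<Longrightarrow> P (indicator A)" and f: "integrable M f"
  shows "P f"
proof (rule closed_L1_induct[OF assms(1,2), of "sets M"])
  show "f \<in> borel_measurable (sigma (space M) (sets M))"
    using borel_measurable_integrable[OF f] by (simp add: measurable_def sets.sigma_sets_eq sets.space_closed)
qed (use assms in \<open>auto simp: Int_stable_def\<close>)

text \<open>Superlevel sets at rational levels generate the measurability of each function. Adding
  finite intersections keeps the family countable, and the empty intersection, cut with
  \<open>space M\<close>, supplies \<open>space M\<close> itself.\<close>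

lemma countable_Int_stable_generator:
  fixes H :: "('a \<Rightarrow> real) set"
  assumes "countable H" and H: "H \<subseteq> borel_measurable M"
  obtains \<A> where "countable \<A>" "Int_stable \<A>" "\<A> \<subseteq> sets M" "space M \<in> \<A>"
    "H \<subseteq> borel_measurable (sigma (space M) \<A>)"
proof -
  define \<G> where "\<G> = (\<lambda>(h, q). {x\<in>space M. h x > q}) ` (H \<times> \<rat>)"
  define \<A> where "\<A> = (\<lambda>F. space M \<inter> \<Inter>F) ` {F. finite F \<and> F \<subseteq> \<G>}"
  have "countable \<G>" unfolding \<G>_def using assms(1) by (intro countable_image countable_SIGMA countable_rat)
  then have "countable \<A>" unfolding \<A>_def by (intro countable_image countable_Collect_finite_subset)
  moreover have "Int_stable \<A>"
  proof (rule Int_stableI)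
    fix a b assume "a \<in> \<A>" "b \<in> \<A>"
    then obtain F G where FG: "finite F" "F \<subseteq> \<G>" "finite G" "G \<subseteq> \<G>"
      and a: "a = space M \<inter> \<Inter>F" and b: "b = space M \<inter> \<Inter>G" by (auto simp: \<A>_def)
    have "a \<inter> b = space M \<inter> \<Inter>(F \<union> G)" unfolding a b by blast
    moreover have "F \<union> G \<in> {F. finite F \<and> F \<subseteq> \<G>}" using FG by simp
    ultimately show "a \<inter> b \<in> \<A>" unfolding \<A>_def by (rule image_eqI)
  qed
  moreover have \<G>_sets: "\<G> \<subseteq> sets M"
    using H unfolding \<G>_def by (auto intro!: borel_measurable_less)
  then have "\<A> \<subseteq> sets M"
    unfolding \<A>_def
  proof (intro image_subsetI)
    fix F assume "F \<in> {F. finite F \<and> F \<subseteq> \<G>}"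
    then have "finite F" "F \<subseteq> sets M" using \<G>_sets by auto
    then show "space M \<inter> \<Inter>F \<in> sets M"
      by (induction F rule: finite_induct) (auto simp: Int_left_commute)
  qed
  moreover have "space M \<in> \<A>"
    unfolding \<A>_def by (rule image_eqI[of _ _ "{}"]) auto
  moreover have "H \<subseteq> borel_measurable (sigma (space M) \<A>)"
  proof
    fix h assume h: "h \<in> H"
    have Pow: "\<A> \<subseteq> Pow (space M)" by (auto simp: \<A>_def)
    have gen: "{x\<in>space M. h x > q} \<in> \<A>" if "q \<in> \<rat>" for q
    proof -
      have "{x\<in>space M. h x > q} \<in> \<G>" unfolding \<G>_def using h that by force
      then show ?thesis unfolding \<A>_def by (intro image_eqI[of _ _ "{{x\<in>space M. h x > q}}"]) auto
    qed
    show "h \<in> borel_measurable (sigma (space M) \<A>)"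
    proof (rule borel_measurableI_greater)
      fix y
      have "{x\<in>space M. h x > y} = (\<Union>q\<in>{q\<in>\<rat>. y < q}. {x\<in>space M. h x > q})"
        using Rats_dense_in_real[of y] by (force intro: less_trans)
      moreover have "\<dots> \<in> sets (sigma (space M) \<A>)"
        using gen Pow countable_subset[OF _ countable_rat, of "{q\<in>\<rat>. y < q}"] by (intro sets.countable_UN') auto
      ultimately show "{x \<in> space (sigma (space M) \<A>). y < h x} \<in> sets (sigma (space M) \<A>)"
        using Pow by simp
    qed
  qed
  ultimately show ?thesis by (rule that)
qed

text \<open>This trades the metric space of classes over the restricted measure for approximation of
  functions on \<open>M\<close> in the seminorm that integrates over \<open>S\<close>, the form in
  which both directions of the theorem use separability.\<close>

lemma separable_L1_restrict_iff:
  assumes S: "S \<in> sets M"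
  shows "separable_space (Metric_space.mtopology
      (L1_space (restrict_space M S) :: ('a \<Rightarrow> real) set set) (L1_dist (restrict_space M S))) \<longleftrightarrow>
    (\<exists>Q. countable Q \<and> (\<forall>q\<in>Q. integrable M q) \<and>
      (\<forall>f. integrable M f \<longrightarrow> (\<forall>e>0. \<exists>q\<in>Q. (\<integral>x. indicator S x * \<bar>f x - q x\<bar> \<partial>M) < (e::real))))"
    (is "?L \<longleftrightarrow> ?R")
proof -
  define N where "N = restrict_space M S"
  interpret Metric_space "L1_space N :: ('a \<Rightarrow> real) set set" "L1_dist N"
    by (rule Metric_space_L1)
  have int_iff: "integrable N f \<longleftrightarrow> integrable M (\<lambda>x. indicator S x * f x)" for f :: "'a \<Rightarrow> real"
    unfolding N_def using S by (subst integrable_restrict_space) auto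
  have int: "integrable N f" if "integrable M f" for f :: "'a \<Rightarrow> real"
    unfolding int_iff using integrable_mult_indicator[OF S that] by simp
  have dist: "L1_dist N (L1_class N f) (L1_class N g) = (\<integral>x. indicator S x * \<bar>f x - g x\<bar> \<partial>M)"
    if "integrable N f" "integrable N g" for f g :: "'a \<Rightarrow> real"
    using S unfolding L1_dist_class[OF that] by (subst N_def, subst integral_restrict_space) auto
  have closure: "mtopology closure_of C = {F\<in>L1_space N. \<forall>e>0. \<exists>G\<in>C. L1_dist N F G < e}"
    if "C \<subseteq> L1_space N" for C :: "('a \<Rightarrow> real) set set"
    unfolding metric_closure_of
    by (intro Collect_cong conj_cong refl all_cong bex_cong) (use that in auto)
  have "?L \<longleftrightarrow> (\<exists>C \<subseteq> L1_space N. countable C \<and> mtopology closure_of C = L1_space N)"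
    unfolding separable_space_def N_def[symmetric] topspace_mtopology by (intro ex_cong1) auto
  also have "\<dots> \<longleftrightarrow> (\<exists>C :: ('a \<Rightarrow> real) set set. C \<subseteq> L1_space N \<and> countable C \<and>
      (\<forall>F\<in>L1_space N. \<forall>e>0. \<exists>G\<in>C. L1_dist N F G < e))"
  proof (rule ex_cong1)
    fix C :: "('a \<Rightarrow> real) set set"
    show "C \<subseteq> L1_space N \<and> countable C \<and> mtopology closure_of C = L1_space N \<longleftrightarrow>
      C \<subseteq> L1_space N \<and> countable C \<and> (\<forall>F\<in>L1_space N. \<forall>e>0. \<exists>G\<in>C. L1_dist N F G < e)"
      by (cases "C \<subseteq> L1_space N") (simp_all add: closure set_eq_iff, blast)
  qed
  also have "\<dots> \<longleftrightarrow> ?R"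
  proof
    assume "\<exists>C :: ('a \<Rightarrow> real) set set. C \<subseteq> L1_space N \<and> countable C \<and> (\<forall>F\<in>L1_space N. \<forall>e>0. \<exists>G\<in>C. L1_dist N F G < e)"
    then obtain C :: "('a \<Rightarrow> real) set set" where C: "C \<subseteq> L1_space N" "countable C"
      and dense: "\<And>F e. F \<in> L1_space N \<Longrightarrow> e > 0 \<Longrightarrow> \<exists>G\<in>C. L1_dist N F G < e" by auto
    \<comment> \<open>Representatives live on \<open>S\<close> only up to their values elsewhere;
      multiplying by \<open>indicator S\<close> extends them by zero to functions integrable on
      \<open>M\<close>.\<close>
    show ?R
    proof (intro exI[of _ "(\<lambda>G x. indicator S x * L1_rep G x) ` C"] conjI allI impI ballI)
      show "countable ((\<lambda>G x. indicator S x * L1_rep G x) ` C)" using C by simp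
    next
      fix q :: "'a \<Rightarrow> real" assume "q \<in> (\<lambda>G x. indicator S x * L1_rep G x) ` C"
      then obtain G where "G \<in> C" "q = (\<lambda>x. indicator S x * L1_rep G x)" by blast
      then show "integrable M q" using C L1_class_rep(1)[of G N] by (auto simp: int_iff)
    next
      fix f :: "'a \<Rightarrow> real" and e :: real assume f: "integrable M f" and "e > 0"
      then obtain G where G: "G \<in> C" "L1_dist N (L1_class N f) G < e"
        using dense[of "L1_class N f" e] int[OF f] by (auto simp: L1_space_eq)
      have G': "integrable N (L1_rep G)" "L1_class N (L1_rep G) = G"
        using L1_class_rep[of G N] C G by auto
      have "(\<integral>x. indicator S x * \<bar>f x - indicator S x * L1_rep G x\<bar> \<partial>M) =
        (\<integral>x. indicator S x * \<bar>f x - L1_rep G x\<bar> \<partial>M)"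
        by (intro Bochner_Integration.integral_cong) (auto simp: indicator_def)
      also have "\<dots> < e" using dist[OF int[OF f] G'(1)] G' G by simp
      finally show "\<exists>q\<in>(\<lambda>G x. indicator S x * L1_rep G x) ` C. (\<integral>x. indicator S x * \<bar>f x - q x\<bar> \<partial>M) < e"
        using G by (intro bexI[of _ "\<lambda>x. indicator S x * L1_rep G x"]) auto
    qed
  next
    assume ?R
    then obtain Q where Q': "countable Q" "\<forall>q\<in>Q. integrable M q"
      and dense': "\<forall>f. integrable M f \<longrightarrow> (\<forall>e>0. \<exists>q\<in>Q. (\<integral>x. indicator S x * \<bar>f x - q x\<bar> \<partial>M) < (e::real))"
      by (elim exE conjE)
    note Q = Q'(1) bspec[OF Q'(2)] and dense = dense'[rule_format]
    show "\<exists>C :: ('a \<Rightarrow> real) set set. C \<subseteq> L1_space N \<and> countable C \<and> (\<forall>F\<in>L1_space N. \<forall>e>0. \<exists>G\<in>C. L1_dist N F G < e)"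
    proof (intro exI[of _ "L1_class N ` Q"] conjI ballI allI impI)
      show "L1_class N ` Q \<subseteq> L1_space N" using Q int by (auto simp: L1_space_eq)
      fix F :: "('a \<Rightarrow> real) set" and e :: real assume F: "F \<in> L1_space N" and "e > 0"
      define f where "f = (\<lambda>x. indicator S x * L1_rep F x)"
      have f: "integrable M f" using L1_class_rep(1)[OF F] by (simp add: f_def int_iff)
      obtain q where q: "q \<in> Q" "(\<integral>x. indicator S x * \<bar>f x - q x\<bar> \<partial>M) < e"
        using dense[OF f \<open>e > 0\<close>] by blast
      have "L1_dist N F (L1_class N q) = (\<integral>x. indicator S x * \<bar>L1_rep F x - q x\<bar> \<partial>M)"
        using dist[OF L1_class_rep(1)[OF F] int[OF Q(2)[OF q(1)]]] L1_class_rep(2)[OF F] by simp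
      also have "\<dots> = (\<integral>x. indicator S x * \<bar>f x - q x\<bar> \<partial>M)"
        by (intro Bochner_Integration.integral_cong) (auto simp: indicator_def f_def)
      finally show "\<exists>G\<in>L1_class N ` Q. L1_dist N F G < e"
        using q by (intro bexI[of _ "L1_class N q"]) auto
    qed (use Q in simp)
  qed
  finally show ?thesis .
qed

lemma integrable_mult_bounded:
  fixes g h :: "'a \<Rightarrow> real"
  assumes [measurable]: "g \<in> borel_measurable M" and g: "\<And>x. \<bar>g x\<bar> \<le> C" and h: "integrable M h"
  shows "integrable M (\<lambda>x. g x * h x)"
proof (rule Bochner_Integration.integrable_bound[of M "\<lambda>x. C * h x"])
  have [measurable]: "h \<in> borel_measurable M" using h by simp
  show "(\<lambda>x. g x * h x) \<in> borel_measurable M" by measurable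
  have "\<bar>g x * h x\<bar> \<le> \<bar>C * h x\<bar>" for x
    using g[of x] by (auto simp: abs_mult intro!: mult_right_mono)
  then show "AE x in M. norm (g x * h x) \<le> norm (C * h x)" by simp
qed (use h in simp)

text \<open>The functions approximable on \<open>S\<close> by rational combinations of indicators
  from \<open>\<A>\<close> form a closed subspace, so \<open>closed_L1_induct\<close> can show that
  this countable family is dense.\<close>

lemma closed_L1_subspace_rational_span:
  fixes \<A> :: "'a set set"
  assumes "finite_measure M" and S: "S \<in> sets M" and \<A>: "countable \<A>" "\<A> \<subseteq> sets M"
  obtains Q where "countable Q" "\<And>q. q \<in> Q \<Longrightarrow> integrable M q" "\<And>A. A \<in> \<A> \<Longrightarrow> indicator A \<in> Q"
    "closed_L1_subspace M (\<lambda>f. \<forall>e>0. \<exists>q\<in>Q. (\<integral>x. indicator S x * \<bar>f x - q x\<bar> \<partial>M) < (e::real))"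
proof -
  interpret finite_measure M by fact
  \<comment> \<open>Combinations are coded by lists: addition becomes concatenation, and
    countability is that of lists over a countable set.\<close>
  define comb :: "(real \<times> 'a set) list \<Rightarrow> 'a \<Rightarrow> real"
    where "comb l x = (\<Sum>(c, A)\<leftarrow>l. c * indicator A x)" for l x
  define Q where "Q = comb ` lists (\<rat> \<times> \<A>)"
  have "countable Q"
    unfolding Q_def using \<A>(1) by (intro countable_image countable_lists countable_SIGMA countable_rat)
  have Q_int: "integrable M q" if "q \<in> Q" for q
  proof -
    obtain l where l: "q = comb l" "l \<in> lists (\<rat> \<times> \<A>)"
      using \<open>q \<in> Q\<close> unfolding Q_def by (rule imageE)
    from l(2) have "integrable M (comb l)"
    proof (induction l)
      case (Cons p l)
      then have "integrable M (\<lambda>x. fst p * indicator (snd p) x + comb l x)"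
        using \<A>(2) by (intro Bochner_Integration.integrable_add integrable_mult_right integrable_real_indicator)
          (auto simp: less_top[symmetric])
      then show ?case by (simp add: comb_def[abs_def] case_prod_beta)
    qed (simp add: comb_def[abs_def])
    then show ?thesis by (simp add: l)
  qed
  have Q_add: "(\<lambda>x. p x + q x) \<in> Q" if "p \<in> Q" "q \<in> Q" for p q
  proof -
    obtain k where k: "p = comb k" "k \<in> lists (\<rat> \<times> \<A>)"
      using \<open>p \<in> Q\<close> unfolding Q_def by (rule imageE)
    obtain l where l: "q = comb l" "l \<in> lists (\<rat> \<times> \<A>)"
      using \<open>q \<in> Q\<close> unfolding Q_def by (rule imageE)
    have "(\<lambda>x. p x + q x) = comb (k @ l)" by (simp add: k l comb_def[abs_def])
    moreover have "k @ l \<in> lists (\<rat> \<times> \<A>)" using k l by simp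
    ultimately show ?thesis unfolding Q_def by (rule image_eqI)
  qed
  have Q_scale: "(\<lambda>x. r * q x) \<in> Q" if "q \<in> Q" "r \<in> \<rat>" for q r
  proof -
    obtain l where l: "q = comb l" "l \<in> lists (\<rat> \<times> \<A>)"
      using \<open>q \<in> Q\<close> unfolding Q_def by (rule imageE)
    have "r * comb l x = comb (map (\<lambda>(c, A). (r * c, A)) l) x" for x
      by (induction l) (auto simp: comb_def algebra_simps)
    then have "(\<lambda>x. r * q x) = comb (map (\<lambda>(c, A). (r * c, A)) l)" by (auto simp: l)
    moreover have "map (\<lambda>(c, A). (r * c, A)) l \<in> lists (\<rat> \<times> \<A>)"
      using l(2) that(2) by (induction l) auto
    ultimately show ?thesis unfolding Q_def by (rule image_eqI)
  qed
  have Q_ind: "indicator A \<in> Q" if "A \<in> \<A>" for A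
  proof -
    have "indicator A = comb [(1, A)]" by (simp add: comb_def[abs_def])
    moreover have "[(1, A)] \<in> lists (\<rat> \<times> \<A>)" using that by simp
    ultimately show ?thesis unfolding Q_def by (rule image_eqI)
  qed
  define d where "d f g = (\<integral>x. indicator S x * \<bar>f x - g x\<bar> \<partial>M)" for f g :: "'a \<Rightarrow> real"
  have d_int: "integrable M (\<lambda>x. indicator S x * \<bar>f x - g x\<bar>)"
    if "integrable M f" "integrable M g" for f g :: "'a \<Rightarrow> real"
    using integrable_mult_indicator[OF S, of "\<lambda>x. \<bar>f x - g x\<bar>"] that by simp
  have d_triangle: "d f h \<le> d f g + d g h" if "integrable M f" "integrable M g" "integrable M h" for f g h
  proof -
    have "d f h \<le> (\<integral>x. indicator S x * \<bar>f x - g x\<bar> + indicator S x * \<bar>g x - h x\<bar> \<partial>M)"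
      unfolding d_def using that
      by (intro integral_mono Bochner_Integration.integrable_add d_int) (auto simp: indicator_def)
    also have "\<dots> = d f g + d g h"
      unfolding d_def using that by (intro Bochner_Integration.integral_add d_int)
    finally show ?thesis .
  qed
  have d_add: "d (\<lambda>x. f x + g x) (\<lambda>x. p x + q x) \<le> d f p + d g q"
    if "integrable M f" "integrable M g" "integrable M p" "integrable M q" for f g p q
  proof -
    have "d (\<lambda>x. f x + g x) (\<lambda>x. p x + q x) \<le> (\<integral>x. indicator S x * \<bar>f x - p x\<bar> + indicator S x * \<bar>g x - q x\<bar> \<partial>M)"
      unfolding d_def using that
      by (intro integral_mono Bochner_Integration.integrable_add d_int) (auto simp: indicator_def)
    also have "\<dots> = d f p + d g q"
      unfolding d_def using that by (intro Bochner_Integration.integral_add d_int)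
    finally show ?thesis .
  qed
  have d_scale: "d (\<lambda>x. c * f x) (\<lambda>x. c * g x) = \<bar>c\<bar> * d f g" for c f g
    unfolding d_def by (subst integral_mult_right_zero[symmetric])
      (auto intro!: Bochner_Integration.integral_cong simp: abs_mult mult_ac simp flip: right_diff_distrib)
  have d_scale2: "d (\<lambda>x. c * f x) (\<lambda>x. r * f x) = \<bar>c - r\<bar> * d f (\<lambda>_. 0)" for c r f
    unfolding d_def by (subst integral_mult_right_zero[symmetric])
      (auto intro!: Bochner_Integration.integral_cong simp: abs_mult mult_ac simp flip: left_diff_distrib)
  have d_nonneg: "d f g \<ge> 0" for f g by (simp add: d_def)
  have d_le: "d f g \<le> (\<integral>x. \<bar>f x - g x\<bar> \<partial>M)" if "integrable M f" "integrable M g" for f g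
    unfolding d_def using that by (intro integral_mono d_int) (auto simp: indicator_def)
  have "closed_L1_subspace M (\<lambda>f. \<forall>e>0. \<exists>q\<in>Q. d f q < e)"
    unfolding closed_L1_subspace_def
  proof (intro conjI allI impI)
    fix f g and e :: real
    assume fg: "integrable M f" "integrable M g" "\<forall>e>0. \<exists>q\<in>Q. d f q < e" "\<forall>e>0. \<exists>q\<in>Q. d g q < e" and e: "e > 0"
    obtain p q where pq: "p \<in> Q" "d f p < e / 2" "q \<in> Q" "d g q < e / 2"
      using fg(3,4) e half_gt_zero by metis
    have "d (\<lambda>x. f x + g x) (\<lambda>x. p x + q x) < e"
      using d_add[OF fg(1,2) Q_int Q_int, of p q] pq by simp
    then show "\<exists>q\<in>Q. d (\<lambda>x. f x + g x) q < e" using Q_add pq by blast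
  next
    fix c :: real and f and e :: real
    assume f: "integrable M f" "\<forall>e>0. \<exists>q\<in>Q. d f q < e" and e: "e > 0"
    \<comment> \<open>The error splits into replacing \<open>f\<close> by \<open>q\<close> and then
      the real \<open>c\<close> by a rational \<open>r\<close>. The \<open>+ 1\<close> in the
      denominators, here and with \<open>K\<close>, covers \<open>c = 0\<close> and
      \<open>K = 0\<close>.\<close>
    have "e / (2 * (\<bar>c\<bar> + 1)) > 0" using e by simp
    then obtain q where q: "q \<in> Q" "d f q < e / (2 * (\<bar>c\<bar> + 1))" using f(2) by blast
    define K where "K = d q (\<lambda>_. 0)"
    have K: "K \<ge> 0" by (simp add: K_def d_nonneg)
    have "c < c + e / (2 * (K + 1))" using e K by simp
    then obtain r where r: "r \<in> \<rat>" "c < r" "r < c + e / (2 * (K + 1))"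
      using Rats_dense_in_real by blast
    have "d (\<lambda>x. c * f x) (\<lambda>x. r * q x) \<le> d (\<lambda>x. c * f x) (\<lambda>x. c * q x) + d (\<lambda>x. c * q x) (\<lambda>x. r * q x)"
      using f Q_int[OF q(1)] by (intro d_triangle) auto
    also have "\<dots> = \<bar>c\<bar> * d f q + \<bar>c - r\<bar> * K" unfolding d_scale d_scale2 K_def ..
    also have "\<dots> < e"
    proof -
      have "\<bar>c\<bar> * d f q \<le> \<bar>c\<bar> * (e / (2 * (\<bar>c\<bar> + 1)))"
        by (intro mult_left_mono) (use q in auto)
      also have "\<dots> < e / 2" using e by (simp add: field_simps)
      finally have 1: "\<bar>c\<bar> * d f q < e / 2" .
      have "\<bar>c - r\<bar> * K \<le> e / (2 * (K + 1)) * K"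
        by (intro mult_right_mono) (use r K in auto)
      also have "\<dots> < e / 2" using e K by (simp add: field_simps)
      finally show ?thesis using 1 by simp
    qed
    finally show "\<exists>q\<in>Q. d (\<lambda>x. c * f x) q < e" using Q_scale[OF q(1) r(1)] by blast
  next
    fix s :: "nat \<Rightarrow> 'a \<Rightarrow> real" and f and e :: real
    assume s: "\<forall>n. integrable M (s n) \<and> (\<forall>e>0. \<exists>q\<in>Q. d (s n) q < e)" and f: "integrable M f"
      and lim: "(\<lambda>n. \<integral>x. \<bar>s n x - f x\<bar> \<partial>M) \<longlonglongrightarrow> 0" and e: "e > 0"
    have "eventually (\<lambda>n. (\<integral>x. \<bar>s n x - f x\<bar> \<partial>M) < e / 2) sequentially"
      by (rule order_tendstoD(2)[OF lim]) (use e in simp)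
    then obtain n where n: "(\<integral>x. \<bar>s n x - f x\<bar> \<partial>M) < e / 2" by (auto simp: eventually_sequentially)
    obtain q where q: "q \<in> Q" "d (s n) q < e / 2" using s e half_gt_zero by metis
    have "d f (s n) \<le> (\<integral>x. \<bar>s n x - f x\<bar> \<partial>M)"
      using d_le[of f "s n"] s f by (simp add: abs_minus_commute)
    then have "d f q < e" using d_triangle[of f "s n" q] s f Q_int[OF q(1)] q n by simp
    then show "\<exists>q\<in>Q. d f q < e" using q by blast
  qed
  then show ?thesis
    using that[of Q] \<open>countable Q\<close> Q_int Q_ind unfolding d_def by blast
qed

text \<open>If every measurable subset of \<open>S\<close> agreed almost everywhere with its
  conditional expectation given \<open>D\<close>, the rational span of the countable generator of
  \<open>D\<close> would be dense over \<open>S\<close>, against saturation. For an exceptional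
  \<open>B\<close>, the function \<open>indicator B\<close> minus its conditional expectation is
  nonzero and orthogonal to every \<open>h \<in> H\<close>, as these are measurable for
  \<open>D\<close>.\<close>

lemma saturated_splitting:
  assumes fin: "finite_measure M" and sat: "saturated M" and S: "S \<in> sets M" "emeasure M S > 0"
    and H: "countable H" "\<And>h. h \<in> H \<Longrightarrow> integrable M h"
  obtains u :: "'a \<Rightarrow> real" where "u \<in> borel_measurable M" "\<And>x. \<bar>u x\<bar> \<le> indicator S x"
    "\<And>h. h \<in> H \<Longrightarrow> (\<integral>x. u x * h x \<partial>M) = 0" "(\<integral>x. (u x)\<^sup>2 \<partial>M) > 0"
proof -
  interpret finite_measure M by fact
  have int_M: "integrable M (indicator A :: 'a \<Rightarrow> real)" if "A \<in> sets M" for A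
    using that by (intro integrable_real_indicator) (auto simp: less_top[symmetric])
  \<comment> \<open>With \<open>indicator S\<close> among the generating functions, \<open>S\<close>
    belongs to \<open>D\<close>; this later forces the conditional expectation of
    \<open>indicator B\<close> to vanish almost everywhere outside \<open>S\<close>.\<close>
  have "insert (indicator S) H \<subseteq> borel_measurable M"
    using H S by auto
  then obtain \<A> where \<A>: "countable \<A>" "Int_stable \<A>" "\<A> \<subseteq> sets M" "space M \<in> \<A>"
    and meas: "insert (indicator S) H \<subseteq> borel_measurable (sigma (space M) \<A>)"
    using countable_Int_stable_generator[of "insert (indicator S) H" M] H(1) by auto
  define D where "D = sigma (space M) \<A>"
  have "subalgebra M D"
    using \<A>(3) sets.space_closed[of M] unfolding subalgebra_def D_def
    by (auto simp: sets_measure_of_conv space_measure_of_conv intro: sets.sigma_sets_subset[THEN subsetD])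
  then interpret sigma_finite_subalgebra M D
    by (intro finite_measure_subalgebra_is_sigma_finite finite_measure_subalgebra.intro
        finite_measure_subalgebra_axioms.intro fin)
  have "\<exists>B\<in>sets M. B \<subseteq> S \<and> \<not> (AE x in M. indicator B x = real_cond_exp M D (indicator B) x)"
  proof (rule ccontr)
    assume "\<not> ?thesis"
    then have AE: "AE x in M. real_cond_exp M D (indicator B) x = indicator B x"
      if "B \<in> sets M" "B \<subseteq> S" for B
      using that by (auto simp: eq_commute)
    obtain Q where Q: "countable Q" "\<And>q. q \<in> Q \<Longrightarrow> integrable M q" "\<And>A. A \<in> \<A> \<Longrightarrow> indicator A \<in> Q"
      and closed: "closed_L1_subspace M (\<lambda>f. \<forall>e>0. \<exists>q\<in>Q. (\<integral>x. indicator S x * \<bar>f x - q x\<bar> \<partial>M) < (e::real))"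
        (is "closed_L1_subspace M ?P")
      using closed_L1_subspace_rational_span[OF fin S(1) \<A>(1,3)] by blast
    have PA: "?P (indicator A)" if "A \<in> \<A>" for A
      using Q(3)[OF that] by (intro allI impI bexI[of _ "indicator A"]) auto
    have "?P f" if "integrable M f" for f
      using fin closed _ that
    proof (rule closed_L1_induct_sets)
      fix B assume B: "B \<in> sets M"
      define E where "E = real_cond_exp M D (indicator (B \<inter> S))"
      have int_E: "integrable M E"
        unfolding E_def using B S by (intro real_cond_exp_int int_M) auto
      have "?P E"
        using fin closed \<A>(2,3,4) PA int_E
        by (rule closed_L1_induct) (simp_all add: E_def flip: D_def)
      then have PB: "?P (indicator (B \<inter> S))"
        by (rule closed_L1_AE[OF closed int_E]) (use B S AE[of "B \<inter> S"] in \<open>auto simp: E_def intro: int_M\<close>)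
      \<comment> \<open>The seminorm does not see what happens outside \<open>S\<close>, so the case
        of subsets of \<open>S\<close> covers all measurable sets.\<close>
      have "(\<integral>x. indicator S x * \<bar>indicator (B \<inter> S) x - q x\<bar> \<partial>M) =
        (\<integral>x. indicator S x * \<bar>indicator B x - q x\<bar> \<partial>M)" for q :: "'a \<Rightarrow> real"
        by (intro Bochner_Integration.integral_cong) (auto simp: indicator_def)
      with PB show "?P (indicator B)" by simp
    qed
    then have "separable_space (Metric_space.mtopology
        (L1_space (restrict_space M S) :: ('a \<Rightarrow> real) set set) (L1_dist (restrict_space M S)))"
      unfolding separable_L1_restrict_iff[OF S(1)] using Q(1,2) by blast
    then show False using sat S unfolding saturated_def by blast
  qed
  then obtain B where B: "B \<in> sets M" "B \<subseteq> S"
    and neq: "\<not> (AE x in M. indicator B x = real_cond_exp M D (indicator B) x)" by blast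
  define E where "E = real_cond_exp M D (indicator B)"
  have [measurable]: "E \<in> borel_measurable M" by (simp add: E_def)
  note [measurable] = B(1) S(1)
  have "AE x in M. real_cond_exp M D (indicator B) x \<le> real_cond_exp M D (indicator S) x"
    by (rule real_cond_exp_mono) (use B S in \<open>auto intro: int_M simp: indicator_def\<close>)
  moreover have "AE x in M. real_cond_exp M D (indicator S) x = indicator S x"
    by (rule real_cond_exp_F_meas) (use S meas in \<open>auto intro: int_M simp: D_def\<close>)
  moreover have "AE x in M. real_cond_exp M D (indicator B) x \<ge> 0"
    by (rule real_cond_exp_pos) (use B in auto)
  ultimately have E: "AE x in M. 0 \<le> E x \<and> E x \<le> indicator S x"
    unfolding E_def by eventually_elim simp
  \<comment> \<open>Clipping makes the bound by \<open>indicator S\<close> hold at every point;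
    almost everywhere it changes nothing.\<close>
  define u where "u x = indicator S x * max (- 1) (min 1 (indicator B x - E x))" for x
  have u_AE: "AE x in M. u x = indicator B x - E x"
    using E by eventually_elim (use B in \<open>auto simp: u_def indicator_def split: if_splits\<close>)
  have [measurable]: "u \<in> borel_measurable M" unfolding u_def by measurable
  have u_le: "\<bar>u x\<bar> \<le> indicator S x" for x by (auto simp: u_def indicator_def)
  show ?thesis
  proof (rule that[of u])
    fix h assume h: "h \<in> H"
    then have [measurable]: "h \<in> borel_measurable M" and hD: "h \<in> borel_measurable D" and int_h: "integrable M h"
      using H meas by (auto simp: D_def)
    have int: "integrable M (\<lambda>x. h x * indicator B x)"
      using integrable_mult_indicator[OF B(1) int_h] by (simp add: mult.commute)
    have "(\<integral>x. u x * h x \<partial>M) = (\<integral>x. h x * indicator B x - h x * E x \<partial>M)"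
    proof (rule integral_cong_AE)
      show "AE x in M. u x * h x = h x * indicator B x - h x * E x"
        using u_AE
      proof eventually_elim
        case (elim x)
        show ?case unfolding elim by (simp add: algebra_simps)
      qed
    qed auto
    also have "\<dots> = 0"
      using real_cond_exp_intg[OF int hD] int by (simp add: E_def)
    finally show "(\<integral>x. u x * h x \<partial>M) = 0" .
  next
    have int: "integrable M (\<lambda>x. (u x)\<^sup>2)"
    proof (rule integrable_const_bound[of _ 1])
      have "\<bar>u x\<bar> \<le> 1" for x using u_le[of x] by (cases "x \<in> S") auto
      then show "AE x in M. norm ((u x)\<^sup>2) \<le> 1" by (simp add: abs_square_le_1)
    qed simp
    have "(\<integral>x. (u x)\<^sup>2 \<partial>M) \<noteq> 0"
    proof
      assume "(\<integral>x. (u x)\<^sup>2 \<partial>M) = 0"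
      then have "AE x in M. u x = 0"
        by (subst (asm) integral_nonneg_eq_0_iff_AE[OF int]) auto
      with u_AE have "AE x in M. indicator B x = E x" by eventually_elim simp
      with neq show False by (simp add: E_def)
    qed
    moreover have "(\<integral>x. (u x)\<^sup>2 \<partial>M) \<ge> 0" by simp
    ultimately show "(\<integral>x. (u x)\<^sup>2 \<partial>M) > 0" by linarith
  qed (use u_le in auto)
qed

section \<open>Lyapunov's theorem on saturated spaces\<close>

text \<open>Each stage adds the current function to its own constraints and takes a nearly maximal
  \<open>N\<close> among the admissible functions. The stages converge in mean to some
  \<open>l\<close>. If \<open>l\<close> were strictly between 0 and 1 on a set of positive measure,
  \<open>saturated_splitting\<close> would yield a perturbation of \<open>l\<close>, admissible at
  every stage, that raises \<open>N\<close> by a fixed \<delta>; then every stage would gain at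
  least half of it, although \<open>N\<close> is bounded.\<close>

lemma saturated_Lyapunov:
  fixes f :: "'a \<Rightarrow> real"
  assumes fin: "finite_measure M" and sat: "saturated M"
    and H: "countable H" "\<And>h. h \<in> H \<Longrightarrow> integrable M h"
    and f: "f \<in> borel_measurable M" "\<And>x. 0 \<le> f x" "\<And>x. f x \<le> 1"
  obtains A where "A \<in> sets M" "\<And>h. h \<in> H \<Longrightarrow> (\<integral>x. indicator A x * h x \<partial>M) = (\<integral>x. f x * h x \<partial>M)"
proof -
  interpret finite_measure M by fact
  define W where "W g \<longleftrightarrow> g \<in> borel_measurable M \<and> (\<forall>x. 0 \<le> g x \<and> g x \<le> 1)" for g :: "'a \<Rightarrow> real"
  define N where "N g = (\<integral>x. g x * g x \<partial>M)" for g :: "'a \<Rightarrow> real"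
  \<comment> \<open>In a state \<open>s\<close>, \<open>fst s\<close> is the set of test functions
    and \<open>snd s\<close> the current function, whose integrals against them are to be
    preserved.\<close>
  define adm where "adm s g \<longleftrightarrow> W g \<and> (\<forall>h\<in>fst s. (\<integral>x. g x * h x \<partial>M) = (\<integral>x. snd s x * h x \<partial>M))"
    for s :: "('a \<Rightarrow> real) set \<times> ('a \<Rightarrow> real)" and g
  have W_int: "integrable M g" if "W g" for g
    using that by (intro integrable_const_bound[of _ 1]) (auto simp: W_def)
  have W_mult: "integrable M (\<lambda>x. g x * h x)" if "W g" "integrable M h" for g h
    using that by (intro integrable_mult_bounded[of _ _ 1]) (auto simp: W_def)
  have N_le: "N g \<le> measure M (space M)" if g: "W g" for g
  proof -
    have "N g \<le> (\<integral>x. 1 \<partial>M)"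
      unfolding N_def
    proof (rule integral_mono)
      show "integrable M (\<lambda>x. g x * g x)" by (rule W_mult[OF g W_int[OF g]])
      show "g x * g x \<le> 1" for x using g by (auto simp: W_def intro: mult_le_one)
    qed simp
    then show ?thesis by simp
  qed
  have N_nonneg: "N g \<ge> 0" for g by (simp add: N_def)
  define good where "good s \<longleftrightarrow> countable (fst s) \<and> (\<forall>h\<in>fst s. integrable M h) \<and> W (snd s) \<and> snd s \<in> fst s"
    for s :: "('a \<Rightarrow> real) set \<times> ('a \<Rightarrow> real)"
  \<comment> \<open>The supremum of \<open>N\<close> need not be attained, so the next function is
    only asked to realise half of the possible gain.\<close>
  define next_of where "next_of s s' \<longleftrightarrow> fst s' = insert (snd s') (fst s) \<and> adm s (snd s') \<and>
      (\<forall>k. adm s k \<longrightarrow> N (snd s') \<ge> (N k + N (snd s)) / 2)"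
    for s s' :: "('a \<Rightarrow> real) set \<times> ('a \<Rightarrow> real)"
  have step: "\<exists>s'. good s' \<and> next_of s s'" if s: "good s" for s
  proof -
    have self: "adm s (snd s)" using s by (auto simp: adm_def good_def)
    define m where "m = (SUP k\<in>Collect (adm s). N k)"
    have bdd: "bdd_above (N ` Collect (adm s))"
      using N_le by (auto intro!: bdd_aboveI2 simp: adm_def)
    have le_m: "N k \<le> m" if "adm s k" for k
      unfolding m_def using that by (intro cSUP_upper bdd) auto
    have "\<exists>g. adm s g \<and> N g \<ge> (m + N (snd s)) / 2"
    proof (cases "N (snd s) < m")
      case True
      then have "(m + N (snd s)) / 2 < m" by simp
      then obtain g where "adm s g" "(m + N (snd s)) / 2 < N g"
        using less_cSupD[of "N ` Collect (adm s)" "(m + N (snd s)) / 2"] self by (auto simp: m_def)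
      then show ?thesis using less_imp_le by blast
    next
      case False
      then show ?thesis using self le_m[OF self] by (intro exI[of _ "snd s"]) auto
    qed
    then obtain g where g: "adm s g" "N g \<ge> (m + N (snd s)) / 2" by blast
    have "N g \<ge> (N k + N (snd s)) / 2" if "adm s k" for k
      using g(2) le_m[OF that] by simp
    then have "next_of s (insert g (fst s), g)" using g by (simp add: next_of_def)
    moreover have "good (insert g (fst s), g)"
      using s g W_int by (auto simp: good_def adm_def)
    ultimately show ?thesis by blast
  qed
  have "W f" using f by (simp add: W_def)
  have "\<exists>s. (\<forall>n. good (s n) \<and> next_of (s n) (s (Suc n))) \<and> s 0 = (insert f H, f)"
  proof -
    have "good (insert f H, f)" using H \<open>W f\<close> W_int by (auto simp: good_def)
    then have "\<exists>s. \<forall>n. (good (s n) \<and> (n = 0 \<longrightarrow> s n = (insert f H, f))) \<and> next_of (s n) (s (Suc n))"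
      by (intro dependent_nat_choice) (use step in auto)
    then show ?thesis by blast
  qed
  then obtain s where s: "\<And>n. good (s n)" "\<And>n. next_of (s n) (s (Suc n))" "s 0 = (insert f H, f)" by blast
  define g where "g n = snd (s n)" for n
  define K where "K n = fst (s n)" for n
  have Wg: "W (g n)" and gK: "g n \<in> K n" and K_int: "\<And>h. h \<in> K n \<Longrightarrow> integrable M h"
    and K_count: "countable (K n)" for n
    using s(1)[of n] by (auto simp: good_def g_def K_def)
  have K_Suc: "K (Suc n) = insert (g (Suc n)) (K n)" and adm_Suc: "adm (s n) (g (Suc n))"
    and near_max: "\<And>k. adm (s n) k \<Longrightarrow> N (g (Suc n)) \<ge> (N k + N (g n)) / 2" for n
    using s(2)[of n] by (auto simp: next_of_def g_def K_def)
  have adm_iff: "adm (s n) k \<longleftrightarrow> W k \<and> (\<forall>h\<in>K n. (\<integral>x. k x * h x \<partial>M) = (\<integral>x. g n x * h x \<partial>M))" for n k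
    by (simp add: adm_def g_def K_def)
  have K_mono: "K i \<subseteq> K j" if "i \<le> j" for i j
    by (rule lift_Suc_mono_le[OF _ that]) (simp add: K_Suc subset_insertI)
  have const: "(\<integral>x. g j x * h x \<partial>M) = (\<integral>x. g i x * h x \<partial>M)" if "i \<le> j" "h \<in> K i" for i j h
    using that(1)
  proof (induction rule: dec_induct)
    case (step n)
    then have "h \<in> K n" using K_mono[of i n] that(2) by auto
    with adm_Suc[of n] have "(\<integral>x. g (Suc n) x * h x \<partial>M) = (\<integral>x. g n x * h x \<partial>M)"
      unfolding adm_iff by blast
    then show ?case using step by simp
  qed simp
  \<comment> \<open>Pythagoras: the constraint against \<open>g i \<in> K i\<close> makes \<open>k - g i\<close> orthogonal to \<open>g i\<close>.\<close>
  have pythagoras: "(\<integral>x. (k x - g i x) * (k x - g i x) \<partial>M) = N k - N (g i)"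
    if "W k" "(\<integral>x. k x * g i x \<partial>M) = (\<integral>x. g i x * g i x \<partial>M)" for k i
  proof -
    have "(\<integral>x. (k x - g i x) * (k x - g i x) \<partial>M) =
        (\<integral>x. k x * k x - 2 * (k x * g i x) + g i x * g i x \<partial>M)"
      by (intro Bochner_Integration.integral_cong refl) (simp add: algebra_simps)
    also have "\<dots> = N k - 2 * (\<integral>x. k x * g i x \<partial>M) + N (g i)"
      unfolding N_def using that(1) Wg[of i] W_mult W_int by simp
    finally show ?thesis using that(2) by (simp add: N_def)
  qed
  have N_diff: "(\<integral>x. (g j x - g i x) * (g j x - g i x) \<partial>M) = N (g j) - N (g i)" if "i \<le> j" for i j
    by (rule pythagoras[OF Wg const[OF that gK]])
  have N_mono: "N (g i) \<le> N (g j)" if "i \<le> j" for i j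
  proof -
    have "0 \<le> (\<integral>x. (g j x - g i x) * (g j x - g i x) \<partial>M)" by simp
    then show ?thesis using N_diff[OF that] by simp
  qed
  have "convergent (\<lambda>n. N (g n))"
    by (rule Bseq_mono_convergent)
      (use N_mono N_le[OF Wg] N_nonneg in \<open>auto intro!: BseqI'[where K = "measure M (space M)"]\<close>)
  then have N_Cauchy: "Cauchy (\<lambda>n. N (g n))" by (rule convergent_Cauchy)
  have L1_Cauchy: "\<exists>n0. \<forall>i\<ge>n0. \<forall>j\<ge>n0. (\<integral>x. norm (g i x - g j x) \<partial>M) < e" if e: "e > 0" for e :: real
  proof -
    \<comment> \<open>The inequality \<open>\<bar>y\<bar> \<le> t + y * y / t\<close> passes from
      mean square to mean distance. The constant \<open>t\<close>, integrated over a finite measure,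
      costs less than \<open>e / 2\<close>; the square term is
      \<open>(N (g j) - N (g i)) / t\<close> and is small because \<open>N (g n)\<close> is
      Cauchy.\<close>
    define t where "t = e / (2 * (measure M (space M) + 1))"
    have \<mu>: "measure M (space M) + 1 > 0" using measure_nonneg[of M "space M"] by linarith
    then have "t > 0" using e by (simp add: t_def)
    moreover have "e / (2 * c) * c = e / 2" if "c > 0" for c using that by simp
    from this[OF \<mu>] have "t * (measure M (space M) + 1) = e / 2" unfolding t_def .
    ultimately have t: "t > 0" "t * measure M (space M) < e / 2" by (simp_all add: distrib_left)
    obtain n0 where n0: "\<And>i j. i \<ge> n0 \<Longrightarrow> j \<ge> n0 \<Longrightarrow> dist (N (g i)) (N (g j)) < t * (e / 2)"
      using metric_CauchyD[OF N_Cauchy, of "t * (e / 2)"] t e by auto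
    have *: "(\<integral>x. \<bar>g j x - g i x\<bar> \<partial>M) < e" if "n0 \<le> i" "i \<le> j" for i j
    proof -
      have g_bounds: "0 \<le> g n x" "g n x \<le> 1" for n x using Wg by (simp_all add: W_def)
      have "\<bar>g j x - g i x\<bar> \<le> 1" for x
        using g_bounds[of i x] g_bounds[of j x] by linarith
      moreover have "integrable M (\<lambda>x. g j x - g i x)" using W_int[OF Wg] by simp
      ultimately have int: "integrable M (\<lambda>x. (g j x - g i x) * (g j x - g i x))"
        by (intro integrable_mult_bounded[of _ _ 1]) auto
      have "(\<integral>x. \<bar>g j x - g i x\<bar> \<partial>M) \<le> (\<integral>x. t + (g j x - g i x) * (g j x - g i x) / t \<partial>M)"
      proof (rule integral_mono)
        fix x
        have "\<bar>y\<bar> \<le> t + y * y / t" for y :: real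
        proof (cases "\<bar>y\<bar> \<le> t")
          case True
          have "y * y / t \<ge> 0" using t by simp
          then show ?thesis using True by linarith
        next
          case False
          then have "t * \<bar>y\<bar> \<le> \<bar>y\<bar> * \<bar>y\<bar>" by (intro mult_right_mono) auto
          then have "\<bar>y\<bar> \<le> y * y / t" using t by (simp add: field_simps)
          then show ?thesis using t by linarith
        qed
        then show "\<bar>g j x - g i x\<bar> \<le> t + (g j x - g i x) * (g j x - g i x) / t" .
      qed (use int Wg W_int in auto)
      also have "\<dots> = t * measure M (space M) + (N (g j) - N (g i)) / t"
        using int N_diff[OF that(2)] by simp
      also have "(N (g j) - N (g i)) / t < e / 2"
      proof -
        have "\<bar>N (g i) - N (g j)\<bar> < t * (e / 2)"
          using n0[of i j] that by (simp add: dist_real_def)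
        then have "N (g j) - N (g i) < t * (e / 2)" by linarith
        then show ?thesis using t by (simp add: field_simps)
      qed
      finally show ?thesis using t(2) by linarith
    qed
    have "(\<integral>x. norm (g i x - g j x) \<partial>M) < e" if "i \<ge> n0" "j \<ge> n0" for i j
      using *[of i j] *[of j i] that by (cases "i \<le> j") (auto simp: abs_minus_commute)
    then show ?thesis by blast
  qed
  obtain r where r: "strict_mono r" and r_Cauchy: "AE x in M. Cauchy (\<lambda>i. g (r i) x)"
    using cauchy_L1_AE_cauchy_subseq[of M g] L1_Cauchy W_int[OF Wg] by blast
  \<comment> \<open>Clipping puts \<open>l\<close> into the interval from 0 to 1 also at the points
    where the subsequence diverges.\<close>
  define l where "l x = max 0 (min 1 (lim (\<lambda>i. g (r i) x)))" for x
  have [measurable]: "g n \<in> borel_measurable M" for n using Wg by (simp add: W_def)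
  have "(\<lambda>x. lim (\<lambda>i. g (r i) x)) \<in> borel_measurable M" by measurable
  then have Wl: "W l" unfolding W_def l_def by auto
  then have [measurable]: "l \<in> borel_measurable M" by (simp add: W_def)
  have lim: "AE x in M. (\<lambda>i. g (r i) x) \<longlonglongrightarrow> l x"
    using r_Cauchy
  proof eventually_elim
    case (elim x)
    then have L: "(\<lambda>i. g (r i) x) \<longlonglongrightarrow> lim (\<lambda>i. g (r i) x)"
      by (simp add: Cauchy_convergent convergent_LIMSEQ_iff[symmetric])
    have "0 \<le> lim (\<lambda>i. g (r i) x)" "lim (\<lambda>i. g (r i) x) \<le> 1"
      using Wg by (auto intro!: LIMSEQ_le_const[OF L] LIMSEQ_le_const2[OF L] simp: W_def)
    then show ?case using L by (simp add: l_def)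
  qed
  \<comment> \<open>Along the subsequence the integrals against \<open>h\<close> are eventually
    constant, so dominated convergence passes every constraint on to the limit.\<close>
  have l_const: "(\<integral>x. l x * h x \<partial>M) = (\<integral>x. g n x * h x \<partial>M)" if h: "h \<in> K n" for h n
  proof (rule LIMSEQ_unique)
    have int_h: "integrable M h" using K_int[OF h] .
    then have [measurable]: "h \<in> borel_measurable M" by simp
    show "(\<lambda>i. \<integral>x. g (r i) x * h x \<partial>M) \<longlonglongrightarrow> (\<integral>x. l x * h x \<partial>M)"
    proof (rule integral_dominated_convergence[where w = "\<lambda>x. \<bar>h x\<bar>"])
      show "AE x in M. (\<lambda>i. g (r i) x * h x) \<longlonglongrightarrow> l x * h x"
        using lim by eventually_elim (intro tendsto_intros)
      have "\<bar>g (r i) x\<bar> \<le> 1" for i x using Wg by (simp add: W_def)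
      then show "AE x in M. norm (g (r i) x * h x) \<le> \<bar>h x\<bar>" for i
        by (intro AE_I2) (simp add: abs_mult mult_left_le_one_le)
    qed (use int_h in auto)
    have "eventually (\<lambda>i. (\<integral>x. g (r i) x * h x \<partial>M) = (\<integral>x. g n x * h x \<partial>M)) sequentially"
      using eventually_ge_at_top[of n]
    proof eventually_elim
      case (elim i)
      then have "n \<le> r i" using seq_suble[OF r, of i] by simp
      then show ?case using h by (rule const)
    qed
    then show "(\<lambda>i. \<integral>x. g (r i) x * h x \<partial>M) \<longlonglongrightarrow> (\<integral>x. g n x * h x \<partial>M)"
      by (rule tendsto_eventually)
  qed
  define S where "S = {x\<in>space M. 0 < l x \<and> l x < 1}"
  have [measurable]: "S \<in> sets M" unfolding S_def by measurable
  have "emeasure M S = 0"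
  proof (rule ccontr)
    assume "emeasure M S \<noteq> 0"
    then have S_pos: "emeasure M S > 0" by (simp add: zero_less_iff_neq_zero)
    \<comment> \<open>\<open>w\<close> is the distance from \<open>l\<close> to the nearer of 0 and
      1, so any perturbation bounded by \<open>w\<close> stays within the range of admissible
      values.\<close>
    define w where "w x = min (l x) (1 - l x)" for x
    have w: "0 \<le> w x" "w x \<le> 1" "w x \<le> l x" "w x \<le> 1 - l x" for x
      using Wl by (auto simp: w_def W_def min_def)
    have [measurable]: "w \<in> borel_measurable M" unfolding w_def by measurable
    \<comment> \<open>Weighting the test functions by \<open>w\<close> makes
      \<open>v = w * u\<close> orthogonal to the original ones. Including \<open>l\<close> removes
      the cross term from \<open>N (l + v)\<close>.\<close>
    define K' where "K' = (\<lambda>h x. w x * h x) ` insert l (\<Union>n. K n)"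
    have "countable K'" unfolding K'_def using K_count by simp
    moreover have "integrable M h" if "h \<in> K'" for h
      using that K_int W_int[OF Wl] w unfolding K'_def
      by (auto intro!: integrable_mult_bounded[of _ _ 1])
    ultimately obtain u where u[measurable]: "u \<in> borel_measurable M" and u_le: "\<And>x. \<bar>u x\<bar> \<le> indicator S x"
      and u0: "\<And>h. h \<in> K' \<Longrightarrow> (\<integral>x. u x * h x \<partial>M) = 0" and u_pos: "(\<integral>x. (u x)\<^sup>2 \<partial>M) > 0"
      using saturated_splitting[OF fin sat \<open>S \<in> sets M\<close> S_pos, of K'] by blast
    have u_le1: "\<bar>u x\<bar> \<le> 1" for x using u_le[of x] by (cases "x \<in> S") auto
    define v where "v x = w x * u x" for x
    have [measurable]: "v \<in> borel_measurable M" unfolding v_def by measurable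
    have v_le: "\<bar>v x\<bar> \<le> w x" for x
      using u_le1[of x] w(1)[of x] by (simp add: v_def abs_mult mult_left_le)
    have v_le1: "\<bar>v x\<bar> \<le> 1" for x using v_le[of x] w(2)[of x] by simp
    have v_int: "integrable M v" using v_le1 by (intro integrable_const_bound[of _ 1]) auto
    have v_mult: "integrable M (\<lambda>x. v x * h x)" if "integrable M h" for h
      by (rule integrable_mult_bounded[OF _ v_le1 that]) simp
    have v0: "(\<integral>x. v x * h x \<partial>M) = 0" if "h \<in> insert l (\<Union>n. K n)" for h
    proof -
      have "(\<lambda>x. w x * h x) \<in> K'" unfolding K'_def using that by (rule imageI)
      from u0[OF this] show ?thesis by (simp add: v_def mult_ac)
    qed
    have vv_int: "integrable M (\<lambda>x. v x * v x)"
      by (rule v_mult[OF v_int])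
    define \<delta> where "\<delta> = (\<integral>x. v x * v x \<partial>M)"
    have "\<delta> \<noteq> 0"
    proof
      assume "\<delta> = 0"
      then have "AE x in M. v x * v x = 0"
        unfolding \<delta>_def by (subst (asm) integral_nonneg_eq_0_iff_AE[OF vv_int]) auto
      then have "AE x in M. (u x)\<^sup>2 = 0"
        using AE_space
      proof eventually_elim
        case (elim x)
        show ?case
        proof (cases "x \<in> S")
          case True
          then have "w x > 0" by (auto simp: S_def w_def)
          then show ?thesis using elim by (simp add: v_def)
        qed (use u_le[of x] in auto)
      qed
      then have "(\<integral>x. (u x)\<^sup>2 \<partial>M) = (\<integral>x. 0 \<partial>M)" by (intro integral_cong_AE) auto
      with u_pos show False by simp
    qed
    moreover have "\<delta> \<ge> 0" unfolding \<delta>_def by simp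
    ultimately have \<delta>: "\<delta> > 0" by linarith
    have W': "W (\<lambda>x. l x + v x)"
      unfolding W_def
    proof (intro conjI allI)
      fix x
      show "0 \<le> l x + v x" "l x + v x \<le> 1" using v_le[of x] w(3,4)[of x] by linarith+
    qed measurable
    have adm': "adm (s n) (\<lambda>x. l x + v x)" for n
      unfolding adm_iff
    proof (intro conjI W' ballI)
      fix h assume h: "h \<in> K n"
      have "(\<integral>x. (l x + v x) * h x \<partial>M) = (\<integral>x. l x * h x \<partial>M) + (\<integral>x. v x * h x \<partial>M)"
        unfolding distrib_right using K_int[OF h] W_mult[OF Wl] v_mult
        by (intro Bochner_Integration.integral_add) auto
      then show "(\<integral>x. (l x + v x) * h x \<partial>M) = (\<integral>x. g n x * h x \<partial>M)"
        using v0[of h] h l_const[OF h] by auto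
    qed
    have N': "N (\<lambda>x. l x + v x) = N l + \<delta>"
    proof -
      have "N (\<lambda>x. l x + v x) = (\<integral>x. l x * l x + 2 * (v x * l x) + v x * v x \<partial>M)"
        unfolding N_def by (intro Bochner_Integration.integral_cong refl) (simp add: algebra_simps)
      also have "\<dots> = N l + 2 * (\<integral>x. v x * l x \<partial>M) + \<delta>"
        unfolding N_def \<delta>_def using vv_int W_mult[OF Wl W_int[OF Wl]] v_mult[OF W_int[OF Wl]]
        by simp
      finally show ?thesis using v0[of l] by simp
    qed
    \<comment> \<open>Pythagoras gives \<open>N l \<ge> N (g n)\<close>, so the competitor
      \<open>l + v\<close> exceeds \<open>g n\<close> by at least \<delta> at every stage, and half
      of that gain must be realised.\<close>
    have grow: "N (g (Suc n)) \<ge> N (g n) + \<delta> / 2" for n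
    proof -
      have "0 \<le> (\<integral>x. (l x - g n x) * (l x - g n x) \<partial>M)" by simp
      also have "\<dots> = N l - N (g n)" by (rule pythagoras[OF Wl l_const[OF gK]])
      finally show ?thesis using near_max[OF adm', of n] N' by simp
    qed
    have "N (g n) \<ge> real n * (\<delta> / 2)" for n
    proof (induction n)
      case (Suc n)
      then show ?case using grow[of n] by (simp add: algebra_simps)
    qed (use N_nonneg in simp)
    then have "real n * (\<delta> / 2) \<le> measure M (space M)" for n
      using N_le[OF Wg[of n]] by (rule order_trans)
    moreover obtain n where "measure M (space M) < real n * (\<delta> / 2)"
      using reals_Archimedean3[of "\<delta> / 2"] \<delta> by auto
    ultimately show False by (meson not_le)
  qed
  then have AE_S: "AE x in M. x \<notin> S" by (intro AE_not_in) (auto simp: null_sets_def)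
  define A where "A = {x\<in>space M. l x = 1}"
  have [measurable]: "A \<in> sets M" unfolding A_def by measurable
  have AE_A: "AE x in M. indicator A x = l x"
    using AE_S AE_space
  proof eventually_elim
    case (elim x)
    moreover have "0 \<le> l x" "l x \<le> 1" using Wl by (simp_all add: W_def)
    ultimately have "l x = 0 \<or> l x = 1" by (auto simp: S_def)
    then show ?case using elim by (auto simp: A_def)
  qed
  show ?thesis
  proof (rule that[of A])
    fix h assume h: "h \<in> H"
    then have [measurable]: "h \<in> borel_measurable M" using H(2) by auto
    have "(\<integral>x. indicator A x * h x \<partial>M) = (\<integral>x. l x * h x \<partial>M)"
    proof (rule integral_cong_AE)
      show "AE x in M. indicator A x * h x = l x * h x"
        using AE_A by eventually_elim simp
    qed auto
    also have "\<dots> = (\<integral>x. g 0 x * h x \<partial>M)" by (rule l_const) (use h s(3) in \<open>simp add: K_def\<close>)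
    finally show "(\<integral>x. indicator A x * h x \<partial>M) = (\<integral>x. f x * h x \<partial>M)"
      by (simp add: g_def s(3))
  qed simp
qed

section \<open>Weak* convergence of indicator functions\<close>

text \<open>Tychonoff's theorem stands in for a diagonal argument: the countable product of
  intervals is compact and metrizable, hence sequentially compact.\<close>

lemma seq_compact_box:
  fixes a :: "nat \<Rightarrow> nat \<Rightarrow> real"
  assumes "\<And>k j. a k j \<in> {0..C}"
  obtains r where "strict_mono r" "\<And>j. convergent (\<lambda>k. a (r k) j)"
proof -
  have "compactin (product_topology (\<lambda>_. euclidean) UNIV) (PiE UNIV (\<lambda>_::nat. {0..C}))"
    by (simp add: compactin_PiE)
  then have "compact (PiE UNIV (\<lambda>_::nat. {0..C}))" by (simp add: euclidean_product_topology)
  then have "seq_compact (PiE UNIV (\<lambda>_::nat. {0..C}))" by (simp add: compact_eq_seq_compact_metric)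
  then obtain l r where "strict_mono r" "(a \<circ> r) \<longlonglongrightarrow> l"
    using assms by (elim seq_compactE[of _ a]) (auto simp: PiE_UNIV_domain)
  then show ?thesis
    by (intro that[of r]) (auto simp: convergent_def o_def dest: continuous_on_tendsto_compose[OF continuous_on_product_coordinates])
qed

text \<open>The uniform bound on \<open>G\<close> makes the integrals depend on \<open>h\<close>
  with Lipschitz constant 1, uniformly in \<open>i\<close>. The filter is arbitrary so that both
  convergence of sequences and the Cauchy property over pairs of indices are covered.\<close>

lemma closed_L1_weak_null:
  fixes M :: "'a measure" and G :: "'i \<Rightarrow> 'a \<Rightarrow> real"
  assumes G[measurable]: "\<And>i. G i \<in> borel_measurable M" and G_le: "\<And>i x. \<bar>G i x\<bar> \<le> (1::real)"
  shows "closed_L1_subspace M (\<lambda>h. ((\<lambda>i. \<integral>x. G i x * h x \<partial>M) \<longlongrightarrow> 0) F)"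
  unfolding closed_L1_subspace_def
proof (intro conjI allI impI)
  have int: "integrable M (\<lambda>x. G i x * h x)" if "integrable M h" for i h
    using that G_le by (intro integrable_mult_bounded) auto
  fix f g assume "integrable M f" "integrable M g"
    "((\<lambda>i. \<integral>x. G i x * f x \<partial>M) \<longlongrightarrow> 0) F" "((\<lambda>i. \<integral>x. G i x * g x \<partial>M) \<longlongrightarrow> 0) F"
  then show "((\<lambda>i. \<integral>x. G i x * (f x + g x) \<partial>M) \<longlongrightarrow> 0) F"
    using int by (auto simp: distrib_left intro: tendsto_add_zero)
next
  fix c f assume "((\<lambda>i. \<integral>x. G i x * f x \<partial>M) \<longlongrightarrow> 0) F"
  then show "((\<lambda>i. \<integral>x. G i x * (c * f x) \<partial>M) \<longlongrightarrow> 0) F"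
    by (simp add: mult.left_commute[of _ c] tendsto_mult_right_zero)
next
  have int: "integrable M (\<lambda>x. G i x * h x)" if "integrable M h" for i h
    using that G_le by (intro integrable_mult_bounded) auto
  fix s :: "nat \<Rightarrow> 'a \<Rightarrow> real" and f
  assume s: "\<forall>n. integrable M (s n) \<and> ((\<lambda>i. \<integral>x. G i x * s n x \<partial>M) \<longlongrightarrow> 0) F" and f: "integrable M f"
    and lim: "(\<lambda>n. \<integral>x. \<bar>s n x - f x\<bar> \<partial>M) \<longlonglongrightarrow> 0"
  have sub: "(\<integral>x. G i x * s n x \<partial>M) - (\<integral>x. G i x * f x \<partial>M) = (\<integral>x. G i x * (s n x - f x) \<partial>M)" for i n
    using int s f by (simp add: right_diff_distrib)
  have bound: "\<bar>(\<integral>x. G i x * s n x \<partial>M) - (\<integral>x. G i x * f x \<partial>M)\<bar> \<le> (\<integral>x. \<bar>s n x - f x\<bar> \<partial>M)" for i n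
  proof -
    have "\<bar>\<integral>x. G i x * (s n x - f x) \<partial>M\<bar> \<le> (\<integral>x. \<bar>G i x * (s n x - f x)\<bar> \<partial>M)"
      by (rule integral_abs_bound)
    also have "\<dots> \<le> (\<integral>x. \<bar>s n x - f x\<bar> \<partial>M)"
    proof (rule integral_mono)
      show "\<bar>G i x * (s n x - f x)\<bar> \<le> \<bar>s n x - f x\<bar>" for x
        using G_le[of i x] by (simp add: abs_mult mult_left_le_one_le)
    qed (use int[of "\<lambda>x. s n x - f x"] s f in auto)
    finally show ?thesis unfolding sub .
  qed
  show "((\<lambda>i. \<integral>x. G i x * f x \<partial>M) \<longlongrightarrow> 0) F"
  proof (rule tendstoI)
    fix e :: real assume e: "e > 0"
    have "eventually (\<lambda>n. (\<integral>x. \<bar>s n x - f x\<bar> \<partial>M) < e / 2) sequentially"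
      by (rule order_tendstoD(2)[OF lim]) (use e in simp)
    then obtain n where n: "(\<integral>x. \<bar>s n x - f x\<bar> \<partial>M) < e / 2" by (auto simp: eventually_sequentially)
    have "((\<lambda>i. \<integral>x. G i x * s n x \<partial>M) \<longlongrightarrow> 0) F" using s by blast
    then have "eventually (\<lambda>i. dist (\<integral>x. G i x * s n x \<partial>M) 0 < e / 2) F"
      by (rule tendstoD) (use e in simp)
    then show "eventually (\<lambda>i. dist (\<integral>x. G i x * f x \<partial>M) 0 < e) F"
    proof eventually_elim
      case (elim i)
      then show ?case using bound[of i n] n by (simp add: dist_real_def)
    qed
  qed
qed

text \<open>Written as a single limit along a product filter, the Cauchy property falls under
  \<open>closed_L1_weak_null\<close>.\<close>

lemma Cauchy_iff_diff_tendsto_0: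
  fixes X :: "nat \<Rightarrow> real"
  shows "Cauchy X \<longleftrightarrow> ((\<lambda>(i, j). X i - X j) \<longlongrightarrow> 0) (sequentially \<times>\<^sub>F sequentially)"
  unfolding Cauchy_def tendsto_iff eventually_prod_sequentially
  by (auto simp: dist_real_def) (metis abs_minus_commute)+

lemma AE_nonneg_of_set_integrals:
  fixes f :: "'a \<Rightarrow> real"
  assumes f: "integrable M f" and "\<And>A. A \<in> sets M \<Longrightarrow> (\<integral>x. indicator A x * f x \<partial>M) \<ge> 0"
  shows "AE x in M. f x \<ge> 0"
proof -
  have [measurable]: "f \<in> borel_measurable M" using f by simp
  define A where "A = {x\<in>space M. f x < 0}"
  have A[measurable]: "A \<in> sets M" unfolding A_def by measurable
  have int: "integrable M (\<lambda>x. - (indicator A x * f x))"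
    using integrable_mult_indicator[OF A f] by simp
  have nonneg: "AE x in M. 0 \<le> - (indicator A x * f x)"
    by (intro AE_I2) (auto simp: A_def indicator_def)
  have "(\<integral>x. - (indicator A x * f x) \<partial>M) = 0"
    using assms(2)[OF A] integral_nonneg_AE[OF nonneg] by simp
  then have "AE x in M. - (indicator A x * f x) = 0"
    using integral_nonneg_eq_0_iff_AE[OF int nonneg] by simp
  then show ?thesis
    using AE_space by eventually_elim (auto simp: A_def indicator_def split: if_splits)
qed

text \<open>Compactness makes the measures of \<open>A (r n) \<inter> C\<close> converge for the
  countably many \<open>C\<close> in a generator of a \<sigma>-algebra containing all the
  \<open>A n\<close>. Conditional expectation extends this to every measurable set. The limit is a
  measure dominated by \<open>M\<close>, whose density is \<open>f\<close>.\<close>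

lemma indicator_weak_star_subsequence:
  assumes fin: "finite_measure M" and A[measurable]: "\<And>n. A n \<in> sets M"
  obtains r :: "nat \<Rightarrow> nat" and f :: "'a \<Rightarrow> real" where "strict_mono r" "f \<in> borel_measurable M"
    "\<And>x. 0 \<le> f x" "\<And>x. f x \<le> 1"
    "\<And>h. integrable M h \<Longrightarrow> (\<lambda>n. \<integral>x. indicator (A (r n)) x * h x \<partial>M) \<longlonglongrightarrow> (\<integral>x. f x * h x \<partial>M)"
proof -
  interpret finite_measure M by fact
  have int_M: "integrable M (indicator B :: 'a \<Rightarrow> real)" if "B \<in> sets M" for B
    using that by (intro integrable_real_indicator) (auto simp: less_top[symmetric])
  define H where "H = range (\<lambda>n. indicator (A n) :: 'a \<Rightarrow> real)"
  have "countable H" "H \<subseteq> borel_measurable M" by (auto simp: H_def)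
  then obtain \<A> where \<A>: "countable \<A>" "Int_stable \<A>" "\<A> \<subseteq> sets M" "space M \<in> \<A>"
    and meas: "H \<subseteq> borel_measurable (sigma (space M) \<A>)"
    by (rule countable_Int_stable_generator)
  define D where "D = sigma (space M) \<A>"
  have "subalgebra M D"
    using \<A>(3) sets.space_closed[of M] unfolding subalgebra_def D_def
    by (auto simp: sets_measure_of_conv space_measure_of_conv intro: sets.sigma_sets_subset[THEN subsetD])
  then interpret sigma_finite_subalgebra M D
    by (intro finite_measure_subalgebra_is_sigma_finite finite_measure_subalgebra.intro
        finite_measure_subalgebra_axioms.intro fin)
  have ind_mult: "(\<integral>x. indicator B x * indicator C x \<partial>M) = measure M (B \<inter> C)"
    if "B \<in> sets M" "C \<in> sets M" for B C
    using that by (simp flip: indicator_inter_arith)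
  obtain r where r: "strict_mono r" and conv: "\<And>j. convergent (\<lambda>k. measure M (A (r k) \<inter> from_nat_into \<A> j))"
    using seq_compact_box[of "\<lambda>k j. measure M (A k \<inter> from_nat_into \<A> j)" "measure M (space M)"]
      bounded_measure by auto
  \<comment> \<open>Only convergence can be tested so far, as no limit function is known yet; hence
    differences over pairs of indices.\<close>
  define G where "G = (\<lambda>(i, j) x. indicator (A (r i)) x - indicator (A (r j)) x :: real)"
  have [measurable]: "G p \<in> borel_measurable M" for p by (cases p) (simp add: G_def)
  have G_le: "\<bar>G p x\<bar> \<le> 1" for p x by (cases p) (simp add: G_def indicator_def)
  define P where "P h \<longleftrightarrow> ((\<lambda>p. \<integral>x. G p x * h x \<partial>M) \<longlongrightarrow> 0) (sequentially \<times>\<^sub>F sequentially)" for h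
  have closed: "closed_L1_subspace M P"
    unfolding P_def by (rule closed_L1_weak_null) (use G_le in auto)
  have ind_int: "integrable M (\<lambda>x. indicator B x * h x)" if "integrable M h" "B \<in> sets M" for h :: "'a \<Rightarrow> real" and B
    using integrable_mult_indicator[OF that(2,1)] by simp
  have P_iff: "P h \<longleftrightarrow> convergent (\<lambda>n. \<integral>x. indicator (A (r n)) x * h x \<partial>M)" if "integrable M h" for h
  proof -
    have "(\<lambda>p. \<integral>x. G p x * h x \<partial>M) = (\<lambda>(i, j). (\<integral>x. indicator (A (r i)) x * h x \<partial>M) - (\<integral>x. indicator (A (r j)) x * h x \<partial>M))"
      by (auto simp: fun_eq_iff G_def left_diff_distrib ind_int that)
    then show ?thesis
      unfolding P_def Cauchy_convergent_iff[symmetric] Cauchy_iff_diff_tendsto_0 by simp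
  qed
  have P_ind: "P (indicator B)" if B: "B \<in> sets M" for B
  proof -
    \<comment> \<open>Each \<open>A k\<close> is measurable for \<open>D\<close>, so
      \<open>indicator B\<close> and its conditional expectation \<open>E\<close> have the same
      integrals over it, and \<open>E\<close> is within reach of the countable generator.\<close>
    define E where "E = real_cond_exp M D (indicator B)"
    have int_E: "integrable M E"
      unfolding E_def using B by (intro real_cond_exp_int int_M)
    have "P E"
      using fin closed \<A>(2,3,4) _ int_E
    proof (rule closed_L1_induct)
      show "E \<in> borel_measurable (sigma (space M) \<A>)" by (simp add: E_def flip: D_def)
      fix C assume C: "C \<in> \<A>"
      then obtain j where "C = from_nat_into \<A> j" using from_nat_into_surj[OF \<A>(1)] by metis
      then show "P (indicator C)"
        using conv[of j] C \<A>(3) ind_mult A by (subst P_iff) (auto intro: int_M)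
    qed
    moreover have "(\<integral>x. indicator (A k) x * E x \<partial>M) = (\<integral>x. indicator (A k) x * indicator B x \<partial>M)" for k
      unfolding E_def
      by (rule real_cond_exp_intg(2)) (use ind_int[OF int_M[OF B]] B meas in \<open>auto simp: H_def D_def\<close>)
    ultimately show ?thesis using P_iff[OF int_E] P_iff[OF int_M[OF B]] by simp
  qed
  define \<nu> where "\<nu> B = lim (\<lambda>n. measure M (A (r n) \<inter> B))" for B
  have \<nu>_lim: "(\<lambda>n. measure M (A (r n) \<inter> B)) \<longlonglongrightarrow> \<nu> B" if "B \<in> sets M" for B
    unfolding \<nu>_def using P_ind[OF that] that
    by (simp add: P_iff int_M ind_mult convergent_LIMSEQ_iff)
  have \<nu>_nonneg: "\<nu> B \<ge> 0" if "B \<in> sets M" for B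
    by (rule LIMSEQ_le_const[OF \<nu>_lim[OF that]]) simp
  have \<nu>_le: "\<nu> B \<le> measure M B" if "B \<in> sets M" for B
    by (rule LIMSEQ_le_const2[OF \<nu>_lim[OF that]]) (use that in \<open>auto intro!: finite_measure_mono\<close>)
  have \<nu>_Un: "\<nu> (B \<union> C) = \<nu> B + \<nu> C" if "B \<in> sets M" "C \<in> sets M" "B \<inter> C = {}" for B C
  proof (rule LIMSEQ_unique[OF \<nu>_lim])
    have "measure M (A (r n) \<inter> (B \<union> C)) = measure M (A (r n) \<inter> B) + measure M (A (r n) \<inter> C)" for n
      unfolding Int_Un_distrib using that by (intro finite_measure_Union) auto
    then show "(\<lambda>n. measure M (A (r n) \<inter> (B \<union> C))) \<longlonglongrightarrow> \<nu> B + \<nu> C"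
      using that by (simp add: tendsto_add \<nu>_lim)
  qed (use that in auto)
  have "vector_measure M \<nu>"
    unfolding vector_measure_def
  proof (intro allI impI)
    fix B :: "nat \<Rightarrow> 'a set" assume B: "range B \<subseteq> sets M" and disj: "disjoint_family B"
    then have [measurable]: "B i \<in> sets M" for i by auto
    define U where "U = (\<Union>i. B i)"
    have [measurable]: "U \<in> sets M" unfolding U_def by measurable
    have sum: "(\<Sum>i<n. \<nu> (B i)) = \<nu> (\<Union>i<n. B i)" for n
    proof (induction n)
      case 0
      show ?case using \<nu>_nonneg[of "{}"] \<nu>_le[of "{}"] by simp
    next
      case (Suc n)
      have "B i \<inter> B n = {}" if "i < n" for i
        using disj that by (intro disjoint_family_onD) auto
      then have "(\<Union>i<n. B i) \<inter> B n = {}" by blast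
      then have "\<nu> ((\<Union>i<n. B i) \<union> B n) = \<nu> (\<Union>i<n. B i) + \<nu> (B n)" by (intro \<nu>_Un) auto
      then show ?case using Suc by (simp add: lessThan_Suc Un_commute)
    qed
    have "(\<lambda>n. measure M (\<Union>i<n. B i)) \<longlonglongrightarrow> measure M U"
    proof -
      have "(\<lambda>n. measure M (\<Union>i<n. B i)) \<longlonglongrightarrow> measure M (\<Union>n. \<Union>i<n. B i)"
        by (rule finite_Lim_measure_incseq) (auto intro!: incseq_SucI simp: lessThan_Suc)
      moreover have "(\<Union>n. \<Union>i<n. B i) = U" unfolding U_def by blast
      ultimately show ?thesis by simp
    qed
    from tendsto_diff[OF tendsto_const[of "measure M U"] this]
    have lim0: "(\<lambda>n. measure M U - measure M (\<Union>i<n. B i)) \<longlonglongrightarrow> 0" by simp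
    \<comment> \<open>Countable additivity comes from domination: the remainder of
      \<open>\<nu>\<close> is squeezed between 0 and the remainder of the finite measure.\<close>
    have "(\<lambda>n. \<nu> U - \<nu> (\<Union>i<n. B i)) \<longlonglongrightarrow> 0"
    proof (rule tendsto_sandwich[OF _ _ tendsto_const lim0])
      have diff: "\<nu> U - \<nu> (\<Union>i<n. B i) = \<nu> (U - (\<Union>i<n. B i))"
        "measure M U - measure M (\<Union>i<n. B i) = measure M (U - (\<Union>i<n. B i))" for n
      proof -
        have *: "(\<Union>i<n. B i) \<union> U = U" by (auto simp: U_def)
        show "\<nu> U - \<nu> (\<Union>i<n. B i) = \<nu> (U - (\<Union>i<n. B i))"
          using \<nu>_Un[of "\<Union>i<n. B i" "U - (\<Union>i<n. B i)"] by (simp add: *)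
        show "measure M U - measure M (\<Union>i<n. B i) = measure M (U - (\<Union>i<n. B i))"
          by (rule finite_measure_Diff[symmetric]) (auto simp: U_def)
      qed
      show "eventually (\<lambda>n. 0 \<le> \<nu> U - \<nu> (\<Union>i<n. B i)) sequentially"
        unfolding diff by (intro always_eventually allI \<nu>_nonneg) measurable
      show "eventually (\<lambda>n. \<nu> U - \<nu> (\<Union>i<n. B i) \<le> measure M U - measure M (\<Union>i<n. B i)) sequentially"
        unfolding diff by (intro always_eventually allI \<nu>_le) measurable
    qed
    from tendsto_diff[OF tendsto_const[of "\<nu> U"] this]
    show "(\<lambda>i. \<nu> (B i)) sums \<nu> (\<Union>i. B i)"
      unfolding sums_def sum U_def[symmetric] by simp
  qed
  moreover have "mu_continuous M \<nu>"
    unfolding mu_continuous_def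
  proof (intro ballI impI)
    fix B assume B: "B \<in> sets M" "emeasure M B = 0"
    then show "\<nu> B = 0" using \<nu>_le[OF B(1)] \<nu>_nonneg[OF B(1)] by (simp add: measure_def)
  qed
  ultimately obtain f0 where f0: "integrable M f0" "\<And>B. B \<in> sets M \<Longrightarrow> \<nu> B = (\<integral>x. indicator B x * f0 x \<partial>M)"
    using vector_measure_density[OF fin] by blast
  have [measurable]: "f0 \<in> borel_measurable M" using f0 by simp
  have "AE x in M. f0 x \<ge> 0"
    using f0(1) by (rule AE_nonneg_of_set_integrals) (use f0(2) \<nu>_nonneg in force)
  moreover have "AE x in M. 1 - f0 x \<ge> 0"
  proof (rule AE_nonneg_of_set_integrals)
    fix B assume B: "B \<in> sets M"
    have "(\<integral>x. indicator B x * (1 - f0 x) \<partial>M) = measure M B - \<nu> B"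
      using B f0(2)[OF B] ind_int[OF f0(1) B] int_M[OF B] by (simp add: right_diff_distrib)
    then show "(\<integral>x. indicator B x * (1 - f0 x) \<partial>M) \<ge> 0" using \<nu>_le[OF B] by simp
  qed (use f0 in auto)
  ultimately have AE01: "AE x in M. 0 \<le> f0 x \<and> f0 x \<le> 1" by eventually_elim simp
  \<comment> \<open>The bounds on the density \<open>f0\<close> hold almost everywhere; clipping
    makes them hold everywhere.\<close>
  define f where "f x = max 0 (min 1 (f0 x))" for x
  have [measurable]: "f \<in> borel_measurable M" unfolding f_def by measurable
  have AE_f: "AE x in M. f x = f0 x" using AE01 by eventually_elim (simp add: f_def)
  have f01: "0 \<le> f x" "f x \<le> 1" for x by (auto simp: f_def)
  show ?thesis
  proof (rule that[OF r _ f01])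
    fix h :: "'a \<Rightarrow> real" assume h: "integrable M h"
    define R where "R = (\<lambda>n x. indicator (A (r n)) x - f x)"
    have R_le: "\<bar>R n x\<bar> \<le> 1" for n x using f01[of x] by (simp add: R_def indicator_def)
    have R_int: "(\<integral>x. R n x * h x \<partial>M) = (\<integral>x. indicator (A (r n)) x * h x \<partial>M) - (\<integral>x. f x * h x \<partial>M)"
      if h: "integrable M h" for n and h :: "'a \<Rightarrow> real"
    proof -
      have "integrable M (\<lambda>x. f x * h x)"
        by (rule integrable_mult_bounded[where C = 1]) (use f01 h in auto)
      then show ?thesis using ind_int[OF h A[of "r n"]] by (simp add: R_def left_diff_distrib)
    qed
    have "closed_L1_subspace M (\<lambda>h. (\<lambda>n. \<integral>x. R n x * h x \<partial>M) \<longlonglongrightarrow> 0)"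
      by (rule closed_L1_weak_null) (use R_le in \<open>auto simp: R_def\<close>)
    with fin have "(\<lambda>n. \<integral>x. R n x * h x \<partial>M) \<longlonglongrightarrow> 0"
      using _ h
    proof (rule closed_L1_induct_sets)
      fix B assume B[measurable]: "B \<in> sets M"
      have "(\<integral>x. f x * indicator B x \<partial>M) = \<nu> B"
        unfolding f0(2)[OF B]
      proof (rule integral_cong_AE)
        show "AE x in M. f x * indicator B x = indicator B x * f0 x"
          using AE_f by eventually_elim simp
      qed auto
      then show "(\<lambda>n. \<integral>x. R n x * indicator B x \<partial>M) \<longlonglongrightarrow> 0"
        using B \<nu>_lim[OF B] by (simp add: R_int int_M ind_mult LIM_zero_iff)
    qed
    then show "(\<lambda>n. \<integral>x. indicator (A (r n)) x * h x \<partial>M) \<longlonglongrightarrow> (\<integral>x. f x * h x \<partial>M)"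
      using R_int[OF h] by (simp add: LIM_zero_iff)
  qed simp
qed

section \<open>Ranges of vector measures and integrals of decomposable sets\<close>

text \<open>Densities are chosen separately for each functional, since a density with values in the
  vector space need not exist.\<close>

lemma real_vector_measure_densities:
  fixes m :: "'a set \<Rightarrow> 'e::real_normed_vector"
  assumes fin: "finite_measure M" and m: "vector_measure M m" "mu_continuous M m"
  obtains h :: "('e \<Rightarrow> real) \<Rightarrow> 'a \<Rightarrow> real"
  where "\<And>\<psi>. bounded_linear \<psi> \<Longrightarrow> integrable M (h \<psi>)"
    "\<And>\<psi> A. bounded_linear \<psi> \<Longrightarrow> A \<in> sets M \<Longrightarrow> \<psi> (m A) = (\<integral>x. indicator A x * h \<psi> x \<partial>M)"
proof -
  define R where "R \<psi> k \<longleftrightarrow> integrable M k \<and> (\<forall>A\<in>sets M. \<psi> (m A) = (\<integral>x. indicator A x * k x \<partial>M))"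
    for \<psi> :: "'e \<Rightarrow> real" and k :: "'a \<Rightarrow> real"
  have "\<exists>k. R \<psi> k" if \<psi>: "bounded_linear \<psi>" for \<psi>
  proof -
    have "mu_continuous M (\<lambda>A. \<psi> (m A))"
      using m(2) by (auto simp: mu_continuous_def linear_simps[OF \<psi>])
    then obtain k where "integrable M k" "\<And>A. A \<in> sets M \<Longrightarrow> \<psi> (m A) = (\<integral>x. indicator A x * k x \<partial>M)"
      using vector_measure_density[OF fin vector_measure_compose[OF m(1) \<psi>]] by blast
    then have "R \<psi> k" by (simp add: R_def)
    then show ?thesis by blast
  qed
  then have *: "R \<psi> (SOME k. R \<psi> k)" if "bounded_linear \<psi>" for \<psi>
    using that by (simp add: some_eq_ex)
  show ?thesis
  proof (rule that[of "\<lambda>\<psi>. SOME k. R \<psi> k"])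
    fix \<psi> :: "'e \<Rightarrow> real" and A assume "bounded_linear \<psi>"
    note R = *[OF this, unfolded R_def[of _ "SOME k. R \<psi> k"]]
    show "integrable M (SOME k. R \<psi> k)" using R by blast
    show "\<psi> (m A) = (\<integral>x. indicator A x * (SOME k. R \<psi> k) x \<partial>M)" if "A \<in> sets M"
      using R that by blast
  qed
qed

text \<open>The value \<open>m A\<close> acts as the integral of \<open>f\<close> against
  \<open>m\<close>. Lyapunov's theorem matches only countably many densities at a time, but a
  countable separating family already determines \<open>m A\<close>, and so every functional is
  matched.\<close>

lemma saturated_vector_measure_attains:
  fixes m :: "'a set \<Rightarrow> 'e::{real_normed_vector,second_countable_topology}"
    and h :: "('e \<Rightarrow> real) \<Rightarrow> 'a \<Rightarrow> real" and f :: "'a \<Rightarrow> real"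
  assumes fin: "finite_measure M" and sat: "saturated M" and m: "vector_measure M m" "mu_continuous M m"
    and h: "\<And>\<psi>. bounded_linear \<psi> \<Longrightarrow> integrable M (h \<psi>)"
      "\<And>\<psi> A. bounded_linear \<psi> \<Longrightarrow> A \<in> sets M \<Longrightarrow> \<psi> (m A) = (\<integral>x. indicator A x * h \<psi> x \<partial>M)"
    and f: "f \<in> borel_measurable M" "\<And>x. 0 \<le> f x" "\<And>x. f x \<le> 1"
  obtains A where "A \<in> sets M" "\<And>\<psi>. bounded_linear \<psi> \<Longrightarrow> \<psi> (m A) = (\<integral>x. f x * h \<psi> x \<partial>M)"
proof -
  obtain \<phi> :: "nat \<Rightarrow> 'e \<Rightarrow> real" where \<phi>: "\<And>n. bounded_linear (\<phi> n)"
    and sep: "\<And>x. (\<And>n. \<phi> n x = 0) \<Longrightarrow> x = 0"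
    by (rule countable_separating_functionals) blast
  have realize: "\<exists>A\<in>sets M. \<forall>\<psi>\<in>insert \<psi>0 (range \<phi>). \<psi> (m A) = (\<integral>x. f x * h \<psi> x \<partial>M)"
    if \<psi>0: "bounded_linear \<psi>0" for \<psi>0
  proof -
    have bl: "bounded_linear \<psi>" if "\<psi> \<in> insert \<psi>0 (range \<phi>)" for \<psi>
      using that \<psi>0 \<phi> by auto
    have "countable (h ` insert \<psi>0 (range \<phi>))" by simp
    moreover have "integrable M k" if "k \<in> h ` insert \<psi>0 (range \<phi>)" for k
      using that bl h(1) by blast
    ultimately obtain A where A: "A \<in> sets M" "\<And>k. k \<in> h ` insert \<psi>0 (range \<phi>) \<Longrightarrow>
        (\<integral>x. indicator A x * k x \<partial>M) = (\<integral>x. f x * k x \<partial>M)"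
      using saturated_Lyapunov[OF fin sat _ _ f, of "h ` insert \<psi>0 (range \<phi>)"] by blast
    show ?thesis
    proof (intro bexI[of _ A] ballI)
      fix \<psi> assume \<psi>: "\<psi> \<in> insert \<psi>0 (range \<phi>)"
      show "\<psi> (m A) = (\<integral>x. f x * h \<psi> x \<partial>M)"
        unfolding h(2)[OF bl[OF \<psi>] A(1)] by (rule A(2)[OF imageI[OF \<psi>]])
    qed (rule A)
  qed
  obtain A where A: "A \<in> sets M" "\<forall>\<psi>\<in>insert (\<phi> 0) (range \<phi>). \<psi> (m A) = (\<integral>x. f x * h \<psi> x \<partial>M)"
    using realize[OF \<phi>] by blast
  show ?thesis
  proof (rule that[OF A(1)])
    fix \<psi> :: "'e \<Rightarrow> real" assume \<psi>: "bounded_linear \<psi>"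
    \<comment> \<open>A set chosen for the family enlarged by \<open>\<psi>\<close> has the same \<open>m\<close>-value, since the \<open>\<phi> n\<close> separate points.\<close>
    obtain B where B: "B \<in> sets M" "\<forall>\<psi>'\<in>insert \<psi> (range \<phi>). \<psi>' (m B) = (\<integral>x. f x * h \<psi>' x \<partial>M)"
      using realize[OF \<psi>] by blast
    have "\<phi> n (m A - m B) = 0" for n
      using A(2) B(2) by (simp add: linear_simps[OF \<phi>])
    then have "m A = m B" using sep[of "m A - m B"] by simp
    then show "\<psi> (m A) = (\<integral>x. f x * h \<psi> x \<partial>M)" using B(2) by simp
  qed
qed

text \<open>The convex combination of the two indicators is a function with values between 0 and 1,
  so some set \<open>D\<close> attains it; a norming functional of the difference turns equality
  under functionals into equality.\<close>

lemma saturated_convex_range: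
  fixes m :: "'a set \<Rightarrow> 'e::{real_normed_vector,second_countable_topology}"
  assumes fin: "finite_measure M" and sat: "saturated M" and m: "vector_measure M m" "mu_continuous M m"
  shows "convex (m ` sets M)"
proof (rule convexI)
  obtain h :: "('e \<Rightarrow> real) \<Rightarrow> 'a \<Rightarrow> real" where h: "\<And>\<psi>. bounded_linear \<psi> \<Longrightarrow> integrable M (h \<psi>)"
      "\<And>\<psi> A. bounded_linear \<psi> \<Longrightarrow> A \<in> sets M \<Longrightarrow> \<psi> (m A) = (\<integral>x. indicator A x * h \<psi> x \<partial>M)"
    by (rule real_vector_measure_densities[OF fin m]) blast
  fix x y and u v :: real
  assume "x \<in> m ` sets M" "y \<in> m ` sets M" and uv: "0 \<le> u" "0 \<le> v" "u + v = 1"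
  then obtain A B where A[measurable]: "A \<in> sets M" and B[measurable]: "B \<in> sets M" and xy: "x = m A" "y = m B"
    by blast
  define f where "f t = u * indicator A t + v * indicator B t" for t :: 'a
  have "f \<in> borel_measurable M" unfolding f_def by measurable
  moreover have "0 \<le> f t" "f t \<le> 1" for t using uv by (auto simp: f_def indicator_def)
  ultimately obtain D where D: "D \<in> sets M" "\<And>\<psi>. bounded_linear \<psi> \<Longrightarrow> \<psi> (m D) = (\<integral>x. f x * h \<psi> x \<partial>M)"
    using saturated_vector_measure_attains[OF fin sat m h] by blast
  have "m D = u *\<^sub>R x + v *\<^sub>R y"
  proof -
    obtain \<psi> where \<psi>: "bounded_linear \<psi>" "\<psi> (m D - (u *\<^sub>R x + v *\<^sub>R y)) = norm (m D - (u *\<^sub>R x + v *\<^sub>R y))"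
      by (rule norming_functional)
    have int: "integrable M (\<lambda>x. indicator A x * h \<psi> x)" "integrable M (\<lambda>x. indicator B x * h \<psi> x)"
      using integrable_mult_indicator[OF A h(1)[OF \<psi>(1)]] integrable_mult_indicator[OF B h(1)[OF \<psi>(1)]] by simp_all
    have "\<psi> (m D) = (\<integral>x. u * (indicator A x * h \<psi> x) + v * (indicator B x * h \<psi> x) \<partial>M)"
      unfolding D(2)[OF \<psi>(1)] f_def
      by (intro Bochner_Integration.integral_cong refl) (simp add: algebra_simps)
    also have "\<dots> = u * \<psi> x + v * \<psi> y"
      using int by (simp add: xy h(2)[OF \<psi>(1)])
    finally have "\<psi> (m D - (u *\<^sub>R x + v *\<^sub>R y)) = 0"
      by (simp add: linear_simps[OF \<psi>(1)])
    then show ?thesis using \<psi>(2) by simp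
  qed
  moreover have "m D \<in> m ` sets M" using D(1) by (rule imageI)
  ultimately show "u *\<^sub>R x + v *\<^sub>R y \<in> m ` sets M" by simp
qed

text \<open>A sequence of sets has a subsequence whose indicators converge weakly* to some
  \<open>f\<close>, and \<open>saturated_vector_measure_attains\<close> replaces \<open>f\<close> by
  a set. This gives weak sequential compactness, which the separating functionals upgrade to
  compactness.\<close>

lemma saturated_weakly_compact_range:
  fixes m :: "'a set \<Rightarrow> 'e::{real_normed_vector,second_countable_topology}"
  assumes fin: "finite_measure M" and sat: "saturated M" and m: "vector_measure M m" "mu_continuous M m"
  shows "compactin weak_topology (m ` sets M)"
proof -
  obtain h :: "('e \<Rightarrow> real) \<Rightarrow> 'a \<Rightarrow> real" where h: "\<And>\<psi>. bounded_linear \<psi> \<Longrightarrow> integrable M (h \<psi>)"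
      "\<And>\<psi> A. bounded_linear \<psi> \<Longrightarrow> A \<in> sets M \<Longrightarrow> \<psi> (m A) = (\<integral>x. indicator A x * h \<psi> x \<partial>M)"
    by (rule real_vector_measure_densities[OF fin m]) blast
  have subseq: "\<exists>r B. strict_mono r \<and> B \<in> sets M \<and> (\<forall>\<psi> :: 'e \<Rightarrow> real. bounded_linear \<psi> \<longrightarrow> (\<lambda>k. \<psi> (m (A (r k)))) \<longlonglongrightarrow> \<psi> (m B))"
    if A: "\<And>k. A k \<in> sets M" for A :: "nat \<Rightarrow> 'a set"
  proof -
    obtain r f where r: "strict_mono r" and f: "f \<in> borel_measurable M" "\<And>x. 0 \<le> f x" "\<And>x. f x \<le> 1"
      and lim: "\<And>k :: 'a \<Rightarrow> real. integrable M k \<Longrightarrow> (\<lambda>n. \<integral>x. indicator (A (r n)) x * k x \<partial>M) \<longlonglongrightarrow> (\<integral>x. f x * k x \<partial>M)"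
      by (rule indicator_weak_star_subsequence[OF fin, of A, OF A]) (rule that, simp_all)
    obtain B where B: "B \<in> sets M" "\<And>\<psi>. bounded_linear \<psi> \<Longrightarrow> \<psi> (m B) = (\<integral>x. f x * h \<psi> x \<partial>M)"
      using saturated_vector_measure_attains[OF fin sat m h f] by blast
    have "(\<lambda>k. \<psi> (m (A (r k)))) \<longlonglongrightarrow> \<psi> (m B)" if "bounded_linear \<psi>" for \<psi> :: "'e \<Rightarrow> real"
      using lim[OF h(1)[OF that]] by (simp add: h(2)[OF that A] B(2)[OF that])
    then show ?thesis using r B(1) by blast
  qed
  obtain \<phi> :: "nat \<Rightarrow> 'e \<Rightarrow> real" where \<phi>: "\<And>n. bounded_linear (\<phi> n)"
    and sep: "\<And>x. (\<And>n. \<phi> n x = 0) \<Longrightarrow> x = 0"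
    by (rule countable_separating_functionals) blast
  \<comment> \<open>\<open>\<Phi>\<close> carries the range onto a subset of a metrizable space, so that compactness can be tested
    with sequences; its inverse is weakly continuous because preimages of closed sets are compact.\<close>
  define \<Phi> where "\<Phi> x n = \<phi> n x" for x n
  have inj: "inj_on \<Phi> X" for X
  proof (rule inj_onI)
    fix x y assume "\<Phi> x = \<Phi> y"
    then have "\<phi> n (x - y) = 0" for n by (simp add: \<Phi>_def fun_eq_iff linear_simps[OF \<phi>])
    then show "x = y" using sep[of "x - y"] by simp
  qed
  \<comment> \<open>The closed constraint \<open>V\<close> on one further functional is what
    continuity of the inverse requires; \<open>V = UNIV\<close> gives compactness of the whole
    image.\<close>
  have compact_part: "compact (\<Phi> ` {y \<in> m ` sets M. \<psi> y \<in> V})" if \<psi>: "bounded_linear \<psi>" and V: "closed V"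
    for \<psi> :: "'e \<Rightarrow> real" and V :: "real set"
    unfolding compact_eq_seq_compact_metric
  proof (rule seq_compactI)
    fix s :: "nat \<Rightarrow> nat \<Rightarrow> real" assume "\<forall>n. s n \<in> \<Phi> ` {y \<in> m ` sets M. \<psi> y \<in> V}"
    then have "\<forall>n. \<exists>A. A \<in> sets M \<and> \<psi> (m A) \<in> V \<and> s n = \<Phi> (m A)" by blast
    then obtain A where A: "\<And>n. A n \<in> sets M" "\<And>n. \<psi> (m (A n)) \<in> V" "\<And>n. s n = \<Phi> (m (A n))"
      by metis
    obtain r B where r: "strict_mono r" and B: "B \<in> sets M"
      and lim': "\<forall>\<psi> :: 'e \<Rightarrow> real. bounded_linear \<psi> \<longrightarrow> (\<lambda>k. \<psi> (m (A (r k)))) \<longlonglongrightarrow> \<psi> (m B)"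
      using subseq[of A, OF A(1)] by (elim exE conjE)
    note lim = lim'[rule_format]
    have "\<psi> (m B) \<in> V"
      using A(2) by (intro closed_sequentially[OF V _ lim[OF \<psi>]])
    moreover have "limitin (product_topology (\<lambda>_. euclidean) UNIV) (s \<circ> r) (\<Phi> (m B)) sequentially"
      unfolding limitin_componentwise using lim[OF \<phi>] by (simp add: A(3) \<Phi>_def)
    then have "(s \<circ> r) \<longlonglongrightarrow> \<Phi> (m B)" by (simp add: euclidean_product_topology)
    ultimately show "\<exists>l\<in>\<Phi> ` {y \<in> m ` sets M. \<psi> y \<in> V}. \<exists>r. strict_mono r \<and> (s \<circ> r) \<longlonglongrightarrow> l"
      using r B by blast
  qed
  define K where "K = \<Phi> ` (m ` sets M)"
  define g where "g = inv_into (m ` sets M) \<Phi>"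
  have g: "g (\<Phi> y) = y" if "y \<in> m ` sets M" for y
    unfolding g_def using that inj by (simp add: inv_into_f_f)
  have "compact K"
    using compact_part[OF bounded_linear_zero closed_UNIV] by (simp add: K_def)
  then have "compactin (top_of_set K) K" by (simp add: compactin_subtopology)
  moreover have "continuous_map (top_of_set K) weak_topology g"
    unfolding weak_topology_def
  proof (rule continuous_on_generated_topo)
    fix W assume "W \<in> {\<psi> -` U |(\<psi> :: 'e \<Rightarrow> real) U. bounded_linear \<psi> \<and> open U}"
    then obtain \<psi> :: "'e \<Rightarrow> real" and U where \<psi>: "bounded_linear \<psi>" and U: "open U" and W: "W = \<psi> -` U" by blast
    have "g -` W \<inter> K = K - \<Phi> ` {y \<in> m ` sets M. \<psi> y \<in> - U}"
    proof -
      have "\<Phi> y \<in> \<Phi> ` {y \<in> m ` sets M. \<psi> y \<in> - U} \<longleftrightarrow> \<psi> y \<in> - U" if "y \<in> m ` sets M" for y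
        using inj_on_image_mem_iff[OF inj[of UNIV], of y "{y \<in> m ` sets M. \<psi> y \<in> - U}"] that by simp
      then show ?thesis by (auto simp: K_def W g)
    qed
    moreover have "closed (\<Phi> ` {y \<in> m ` sets M. \<psi> y \<in> - U})"
      by (rule compact_imp_closed[OF compact_part[OF \<psi> closed_Compl[OF U]]])
    ultimately show "openin (top_of_set K) (g -` W \<inter> topspace (top_of_set K))"
      by (simp add: Diff_eq openin_open_Int open_Compl)
  next
    have "\<Union> {\<psi> -` U |(\<psi> :: 'e \<Rightarrow> real) U. bounded_linear \<psi> \<and> open U} = UNIV"
      using topspace_weak_topology[where 'b = 'e] unfolding weak_topology_def topology_generated_by_topspace .
    then show "g ` topspace (top_of_set K) \<subseteq> \<Union> {\<psi> -` U |(\<psi> :: 'e \<Rightarrow> real) U. bounded_linear \<psi> \<and> open U}"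
      by simp
  qed
  ultimately have "compactin weak_topology (g ` K)" by (rule image_compactin)
  moreover have "g ` K = m ` sets M"
    unfolding K_def image_image by (intro image_cong refl g imageI)
  ultimately show ?thesis by simp
qed

section \<open>Indefinite integrals and decomposable sets\<close>

lemma indefinite_integral_vector_measure:
  fixes f :: "'a \<Rightarrow> 'e::{banach,second_countable_topology}"
  assumes f: "integrable M f"
  shows "vector_measure M (\<lambda>A. \<integral>x. indicator A x *\<^sub>R f x \<partial>M)"
    and "mu_continuous M (\<lambda>A. \<integral>x. indicator A x *\<^sub>R f x \<partial>M)"
proof -
  have [measurable]: "f \<in> borel_measurable M" using f by simp
  show "vector_measure M (\<lambda>A. \<integral>x. indicator A x *\<^sub>R f x \<partial>M)"
    unfolding vector_measure_def
  proof (intro allI impI)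
    fix A :: "nat \<Rightarrow> 'a set" assume A: "range A \<subseteq> sets M" and disj: "disjoint_family A"
    then have [measurable]: "A i \<in> sets M" for i by auto
    have int: "integrable M (\<lambda>x. indicator (A i) x *\<^sub>R f x)" for i
      by (rule integrable_mult_indicator[OF _ f]) simp
    have sum_ind: "(\<Sum>i<n. indicator (A i) x) = (indicator (\<Union>i<n. A i) x :: real)" for n x
      using disj by (intro indicator_UN_disjoint[symmetric]) (auto simp: disjoint_family_on_def)
    have "(\<lambda>n. \<integral>x. indicator (\<Union>i<n. A i) x *\<^sub>R f x \<partial>M) \<longlonglongrightarrow> (\<integral>x. indicator (\<Union>i. A i) x *\<^sub>R f x \<partial>M)"
    proof (rule integral_dominated_convergence[where w = "\<lambda>x. norm (f x)"])
      show "AE x in M. (\<lambda>n. indicator (\<Union>i<n. A i) x *\<^sub>R f x) \<longlonglongrightarrow> indicator (\<Union>i. A i) x *\<^sub>R f x"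
        by (intro AE_I2 tendsto_scaleR LIMSEQ_indicator_UN tendsto_const)
      show "AE x in M. norm (indicator (\<Union>i<n. A i) x *\<^sub>R f x) \<le> norm (f x)" for n
        by (intro AE_I2) (simp add: indicator_def)
    qed (use f in auto)
    moreover have "(\<integral>x. indicator (\<Union>i<n. A i) x *\<^sub>R f x \<partial>M) = (\<Sum>i<n. \<integral>x. indicator (A i) x *\<^sub>R f x \<partial>M)" for n
      unfolding sum_ind[symmetric] scaleR_sum_left using int by (intro Bochner_Integration.integral_sum)
    ultimately show "(\<lambda>i. \<integral>x. indicator (A i) x *\<^sub>R f x \<partial>M) sums (\<integral>x. indicator (\<Union>i. A i) x *\<^sub>R f x \<partial>M)"
      by (simp add: sums_def)
  qed
  show "mu_continuous M (\<lambda>A. \<integral>x. indicator A x *\<^sub>R f x \<partial>M)"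
    unfolding mu_continuous_def
  proof (intro ballI impI)
    fix A assume A[measurable]: "A \<in> sets M" and "emeasure M A = 0"
    then have "AE x in M. x \<notin> A" by (intro AE_not_in) (auto simp: null_sets_def)
    then have "AE x in M. indicator A x *\<^sub>R f x = 0" by eventually_elim simp
    then have "(\<integral>x. indicator A x *\<^sub>R f x \<partial>M) = (\<integral>x. 0 \<partial>M)" by (intro integral_cong_AE) auto
    then show "(\<integral>x. indicator A x *\<^sub>R f x \<partial>M) = 0" by simp
  qed
qed

lemma L1_class_eq:
  assumes "integrable M f" "integrable M g" "AE x in M. f x = g x"
  shows "L1_class M f = L1_class M g"
  unfolding L1_class_def by (rule equiv_class_eq[OF equiv_L1_rel]) (use assms in \<open>simp add: L1_rel_def\<close>)

text \<open>With \<open>m A\<close> the integral of \<open>f - g\<close> over \<open>A\<close>,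
  splicing \<open>f\<close> on \<open>D\<close> with \<open>g\<close> elsewhere has integral
  \<open>m D\<close> plus that of \<open>g\<close>. Convexity of the range of \<open>m\<close>,
  applied to \<open>space M\<close> and the empty set, provides the right \<open>D\<close>.\<close>

lemma decomposable_integrals_convex:
  fixes K :: "('a \<Rightarrow> 'e::{banach,second_countable_topology}) set set"
  assumes fin: "finite_measure M" and sat: "saturated M" and K: "decomposable M K"
  shows "convex (L1_integral M ` K)"
proof (rule convexI)
  fix y z and u v :: real
  assume "y \<in> L1_integral M ` K" "z \<in> L1_integral M ` K" and uv: "0 \<le> u" "0 \<le> v" "u + v = 1"
  then obtain F G where FG: "F \<in> K" "G \<in> K" and y: "y = L1_integral M F" and z: "z = L1_integral M G" by blast
  have L1: "F \<in> L1_space M" "G \<in> L1_space M" using K FG by (auto simp: decomposable_def)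
  define f g where "f = L1_rep F" and "g = L1_rep G"
  have int: "integrable M f" "integrable M g" and F: "L1_class M f = F" and G: "L1_class M g = G"
    using L1_class_rep[OF L1(1)] L1_class_rep[OF L1(2)] by (simp_all add: f_def g_def)
  have mem: "f \<in> F" "g \<in> G" using int F G L1_class_iff by blast+
  define m where "m A = (\<integral>x. indicator A x *\<^sub>R (f x - g x) \<partial>M)" for A
  have "vector_measure M m" "mu_continuous M m"
    unfolding m_def using int by (auto intro!: indefinite_integral_vector_measure)
  then have "convex (m ` sets M)" by (rule saturated_convex_range[OF fin sat])
  then have "u *\<^sub>R m (space M) + v *\<^sub>R m {} \<in> m ` sets M"
    using uv by (intro convexD) auto
  then obtain D where D: "D \<in> sets M" and mD: "m D = u *\<^sub>R m (space M) + v *\<^sub>R m {}" by force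
  have m_space: "m (space M) = (\<integral>x. f x \<partial>M) - (\<integral>x. g x \<partial>M)"
  proof -
    have "m (space M) = (\<integral>x. f x - g x \<partial>M)"
      unfolding m_def by (intro Bochner_Integration.integral_cong) auto
    then show ?thesis using int by simp
  qed
  define k where "k x = indicator D x *\<^sub>R f x + (1 - indicator D x) *\<^sub>R g x" for x
  have k: "k x = g x + indicator D x *\<^sub>R (f x - g x)" for x
    by (simp add: k_def algebra_simps)
  have int_D: "integrable M (\<lambda>x. indicator D x *\<^sub>R (f x - g x))"
    using int by (intro integrable_mult_indicator[OF D]) auto
  have "integrable M k" using int int_D by (simp add: k[abs_def])
  then have "L1_integral M (L1_class M k) = (\<integral>x. k x \<partial>M)" by (rule L1_integral_class)
  also have "\<dots> = (\<integral>x. g x \<partial>M) + m D"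
    unfolding k m_def by (rule Bochner_Integration.integral_add[OF int(2) int_D])
  also have "\<dots> = (\<integral>x. g x \<partial>M) + u *\<^sub>R ((\<integral>x. f x \<partial>M) - (\<integral>x. g x \<partial>M))"
    unfolding mD m_space by (simp add: m_def)
  also have "\<dots> = u *\<^sub>R (\<integral>x. f x \<partial>M) + (1 - u) *\<^sub>R (\<integral>x. g x \<partial>M)" by (simp add: algebra_simps)
  also have "\<dots> = u *\<^sub>R y + v *\<^sub>R z"
  proof -
    have "v = 1 - u" using uv(3) by simp
    then show ?thesis by (simp add: y z L1_integral_def f_def g_def)
  qed
  finally have "u *\<^sub>R y + v *\<^sub>R z = L1_integral M (L1_class M k)" by simp
  moreover have "L1_class M k \<in> K"
    using K FG mem D unfolding decomposable_def k_def by blast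
  ultimately show "u *\<^sub>R y + v *\<^sub>R z \<in> L1_integral M ` K" by blast
qed

text \<open>Splicing the cut-offs of \<open>f\<close> to \<open>A\<close> and to \<open>B\<close>
  along \<open>D\<close> gives the cut-off to \<open>(A \<inter> D) \<union> (B - D)\<close>. Thus a
  nonconvex range of an indefinite integral is also a nonconvex set of integrals over a decomposable
  family.\<close>

lemma decomposable_indicator_multiples:
  fixes f :: "'a \<Rightarrow> 'e::{banach,second_countable_topology}"
  assumes f: "integrable M f"
  defines "K \<equiv> (\<lambda>A. L1_class M (\<lambda>x. indicator A x *\<^sub>R f x)) ` sets M"
  shows "decomposable M K" and "L1_integral M ` K = (\<lambda>A. \<integral>x. indicator A x *\<^sub>R f x \<partial>M) ` sets M"
proof -
  have int: "integrable M (\<lambda>x. indicator A x *\<^sub>R f x)" if "A \<in> sets M" for A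
    by (rule integrable_mult_indicator[OF that f])
  show "L1_integral M ` K = (\<lambda>A. \<integral>x. indicator A x *\<^sub>R f x \<partial>M) ` sets M"
    unfolding K_def image_image by (intro image_cong refl) (simp add: L1_integral_class int)
  show "decomposable M K"
    unfolding decomposable_def
  proof (intro conjI ballI)
    show "K \<subseteq> L1_space M" using int by (auto simp: K_def L1_space_eq)
    fix F G p q D assume "F \<in> K" "G \<in> K" and pq: "p \<in> F" "q \<in> G" and D: "D \<in> sets M"
    then obtain A B where AB: "A \<in> sets M" "B \<in> sets M"
      and FG: "F = L1_class M (\<lambda>x. indicator A x *\<^sub>R f x)" "G = L1_class M (\<lambda>x. indicator B x *\<^sub>R f x)"
      unfolding K_def by blast
    have p: "integrable M p" "AE x in M. indicator A x *\<^sub>R f x = p x"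
      using pq(1) L1_class_iff[OF int[OF AB(1)]] by (auto simp: FG)
    have q: "integrable M q" "AE x in M. indicator B x *\<^sub>R f x = q x"
      using pq(2) L1_class_iff[OF int[OF AB(2)]] by (auto simp: FG)
    define E where "E = (A \<inter> D) \<union> (B - D)"
    have E: "E \<in> sets M" using AB D by (auto simp: E_def)
    have "L1_class M (\<lambda>x. indicator D x *\<^sub>R p x + (1 - indicator D x) *\<^sub>R q x) = L1_class M (\<lambda>x. indicator E x *\<^sub>R f x)"
    proof (rule L1_class_eq)
      have "integrable M (\<lambda>x. indicator D x *\<^sub>R p x + (q x - indicator D x *\<^sub>R q x))"
        using p q D by (intro Bochner_Integration.integrable_add Bochner_Integration.integrable_diff integrable_mult_indicator)
      then show "integrable M (\<lambda>x. indicator D x *\<^sub>R p x + (1 - indicator D x) *\<^sub>R q x)"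
        by (simp add: scaleR_left_diff_distrib)
      show "AE x in M. indicator D x *\<^sub>R p x + (1 - indicator D x) *\<^sub>R q x = indicator E x *\<^sub>R f x"
        using p(2) q(2)
      proof eventually_elim
        case (elim x)
        show ?case unfolding elim[symmetric] by (auto simp: E_def indicator_def)
      qed
    qed (rule int[OF E])
    then show "L1_class M (\<lambda>x. indicator D x *\<^sub>R p x + (1 - indicator D x) *\<^sub>R q x) \<in> K"
      using E by (simp add: K_def)
  qed
qed

section \<open>Spaces that are not saturated\<close>

text \<open>The common kernel has finite codimension: modulo it, every vector lies in the span of a
  finite \<open>B\<close>, which grows by at most one vector per functional. A vector outside this
  span yields a nonzero kernel element.\<close>

lemma finite_functionals_common_kernel:
  fixes F :: "('e::real_vector \<Rightarrow> real) set"
  assumes "finite F" and lin: "\<And>\<eta>. \<eta> \<in> F \<Longrightarrow> linear \<eta>"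
    and infinite_dim: "\<nexists>B :: 'e set. finite B \<and> span B = UNIV"
  obtains x where "x \<noteq> 0" "\<And>\<eta>. \<eta> \<in> F \<Longrightarrow> \<eta> x = 0"
proof -
  have "\<exists>B. finite B \<and> (\<forall>x. \<exists>b\<in>span B. \<forall>\<eta>\<in>F. \<eta> (x - b) = 0)"
    using assms(1) lin
  proof (induction F rule: finite_induct)
    case empty
    show ?case by (intro exI[of _ "{}"]) auto
  next
    case (insert \<eta> F)
    have \<eta>: "linear \<eta>" and F: "\<And>\<theta>. \<theta> \<in> F \<Longrightarrow> linear \<theta>" using insert by auto
    obtain B where B: "finite B" "\<And>x. \<exists>b\<in>span B. \<forall>\<theta>\<in>F. \<theta> (x - b) = 0"
      using insert by auto
    show ?case
    proof (cases "\<forall>z. (\<forall>\<theta>\<in>F. \<theta> z = 0) \<longrightarrow> \<eta> z = 0")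
      case True
      have "\<exists>b\<in>span B. \<forall>\<theta>\<in>insert \<eta> F. \<theta> (x - b) = 0" for x
      proof -
        obtain b where b: "b \<in> span B" "\<forall>\<theta>\<in>F. \<theta> (x - b) = 0" using B(2) by blast
        then show ?thesis using True by (intro bexI[of _ b]) auto
      qed
      then show ?thesis using B(1) by blast
    next
      case False
      then obtain v where v: "\<forall>\<theta>\<in>F. \<theta> v = 0" "\<eta> v \<noteq> 0" by blast
      have "\<exists>b\<in>span (insert v B). \<forall>\<theta>\<in>insert \<eta> F. \<theta> (x - b) = 0" for x
      proof -
        obtain b where b: "b \<in> span B" "\<forall>\<theta>\<in>F. \<theta> (x - b) = 0" using B(2) by blast
        define c where "c = \<eta> (x - b) / \<eta> v"
        have "b + c *\<^sub>R v \<in> span (insert v B)"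
        proof (intro span_add span_scale)
          show "b \<in> span (insert v B)" using b(1) span_mono[of B "insert v B"] by blast
        qed (simp add: span_base)
        moreover have "\<theta> (x - (b + c *\<^sub>R v)) = 0" if \<theta>: "\<theta> \<in> insert \<eta> F" for \<theta>
        proof -
          have "linear \<theta>" using \<theta> \<eta> F by blast
          then have "\<theta> (x - (b + c *\<^sub>R v)) = \<theta> (x - b) - c * \<theta> v"
            by (simp add: linear_diff linear_add linear_scale)
          then show ?thesis using \<theta> b v by (auto simp: c_def)
        qed
        ultimately show ?thesis by blast
      qed
      then show ?thesis using B(1) by (intro exI[of _ "insert v B"]) auto
    qed
  qed
  then obtain B where B: "finite B" "\<And>x. \<exists>b\<in>span B. \<forall>\<eta>\<in>F. \<eta> (x - b) = 0" by blast
  then obtain y where y: "y \<notin> span B" using infinite_dim by blast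
  obtain b where b: "b \<in> span B" "\<forall>\<eta>\<in>F. \<eta> (y - b) = 0" using B(2) by blast
  show ?thesis by (rule that[of "y - b"]) (use y b in auto)
qed

text \<open>Recursively, \<open>x n\<close> is a nonzero common zero of the earlier functionals and
  \<open>\<phi> n\<close> norms it. In a state, the first component collects these earlier
  functionals. The triangular shape lets coefficients of a series in the \<open>x n\<close> be
  recovered one after another.\<close>

lemma triangular_system:
  assumes infinite_dim: "\<nexists>B :: 'e set. finite B \<and> span B = UNIV"
  obtains x :: "nat \<Rightarrow> 'e::real_normed_vector" and \<phi> :: "nat \<Rightarrow> 'e \<Rightarrow> real" where "\<And>n. bounded_linear (\<phi> n)"
    "\<And>n. \<phi> n (x n) \<noteq> 0" "\<And>n k. n < k \<Longrightarrow> \<phi> n (x k) = 0"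
proof -
  define good where "good s \<longleftrightarrow> (case s of (F, x, \<psi>) \<Rightarrow> finite F \<and> (\<forall>\<eta>\<in>F. bounded_linear \<eta> \<and> \<eta> x = 0) \<and>
      bounded_linear \<psi> \<and> \<psi> x \<noteq> 0)" for s :: "('e \<Rightarrow> real) set \<times> 'e \<times> ('e \<Rightarrow> real)"
  have extend: "\<exists>s. good s \<and> fst s = F"
    if F: "finite F" "\<And>\<eta>. \<eta> \<in> F \<Longrightarrow> bounded_linear \<eta>" for F
  proof -
    have "\<And>\<eta>. \<eta> \<in> F \<Longrightarrow> linear \<eta>" using F(2) bounded_linear.linear by blast
    then obtain x where x: "x \<noteq> 0" "\<And>\<eta>. \<eta> \<in> F \<Longrightarrow> \<eta> x = 0"
      using finite_functionals_common_kernel[OF F(1) _ infinite_dim] by blast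
    obtain \<psi> where "bounded_linear \<psi>" "\<psi> x = norm x" by (rule norming_functional[of x])
    then have "good (F, x, \<psi>)" using F x by (simp add: good_def)
    then show ?thesis by (intro exI[of _ "(F, x, \<psi>)"]) simp
  qed
  have "\<exists>s. \<forall>n. good (s n) \<and> fst (s (Suc n)) = insert (snd (snd (s n))) (fst (s n))"
  proof (rule dependent_nat_choice[where P = "\<lambda>_. good"])
    show "\<exists>s. good s" using extend[of "{}"] by auto
    fix s assume s: "good s"
    then show "\<exists>s'. good s' \<and> fst s' = insert (snd (snd s)) (fst s)"
      by (intro extend) (auto simp: good_def split: prod.splits)
  qed
  then obtain s where s: "\<And>n. good (s n)" "\<And>n. fst (s (Suc n)) = insert (snd (snd (s n))) (fst (s n))"
    by auto
  define x \<phi> where "x n = fst (snd (s n))" and "\<phi> n = snd (snd (s n))" for n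
  have mono: "fst (s i) \<subseteq> fst (s j)" if "i \<le> j" for i j
    by (rule lift_Suc_mono_le[OF _ that]) (simp add: s(2) subset_insertI)
  have good: "bounded_linear (\<phi> n)" "\<phi> n (x n) \<noteq> 0" "\<eta> \<in> fst (s n) \<Longrightarrow> \<eta> (x n) = 0" for n \<eta>
    using s(1)[of n] by (auto simp: good_def x_def \<phi>_def split: prod.splits)
  show ?thesis
  proof (rule that[of \<phi> x])
    fix n k :: nat assume "n < k"
    then have "\<phi> n \<in> fst (s k)" using mono[of "Suc n" k] s(2)[of n] by (auto simp: \<phi>_def)
    then show "\<phi> n (x k) = 0" by (rule good(3))
  qed (rule good)+
qed

section \<open>An indefinite integral with nonconvex range\<close>

lemma AE_summable_of_summable_integrals:
  fixes g :: "nat \<Rightarrow> 'a \<Rightarrow> 'e::{banach,second_countable_topology}"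
  assumes g: "\<And>n. integrable M (g n)" and summ: "summable (\<lambda>n. \<integral>x. norm (g n x) \<partial>M)"
  shows "AE x in M. summable (\<lambda>n. norm (g n x))"
proof -
  have [measurable]: "g n \<in> borel_measurable M" for n using g by simp
  have "(\<integral>\<^sup>+x. (\<Sum>n. ennreal (norm (g n x))) \<partial>M) = (\<Sum>n. \<integral>\<^sup>+x. ennreal (norm (g n x)) \<partial>M)"
    by (rule nn_integral_suminf) simp
  also have "\<dots> = (\<Sum>n. ennreal (\<integral>x. norm (g n x) \<partial>M))"
    using g by (intro suminf_cong nn_integral_eq_integral) auto
  also have "\<dots> = ennreal (\<Sum>n. \<integral>x. norm (g n x) \<partial>M)"
    by (rule suminf_ennreal2[OF _ summ]) simp
  finally have "(\<integral>\<^sup>+x. (\<Sum>n. ennreal (norm (g n x))) \<partial>M) \<noteq> \<infinity>" by simp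
  then have "AE x in M. (\<Sum>n. ennreal (norm (g n x))) \<noteq> \<infinity>"
    by (intro nn_integral_PInf_AE) auto
  then show ?thesis
    by eventually_elim (auto intro: summable_suminf_not_top)
qed

text \<open>If the midpoint of the values at \<open>S\<close> and at the empty set were attained at
  \<open>D\<close>, the triangular system would make \<open>w = indicator D - 1 / 2\<close>
  orthogonal to every \<open>h n\<close>. These are dense over \<open>S\<close>, while
  \<open>w\<close> has absolute value \<open>1 / 2\<close> there.\<close>

lemma not_saturated_nonconvex_range:
  fixes M :: "'a measure"
  assumes fin: "finite_measure M" and not_sat: "\<not> saturated M"
    and infinite_dim: "\<nexists>B :: 'e set. finite B \<and> span B = UNIV"
  obtains f :: "'a \<Rightarrow> 'e::{banach,second_countable_topology}" where "integrable M f" "\<not> convex ((\<lambda>A. \<integral>x. indicator A x *\<^sub>R f x \<partial>M) ` sets M)"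
proof -
  interpret finite_measure M by fact
  obtain S where S[measurable]: "S \<in> sets M" and S_pos: "emeasure M S > 0"
    and "separable_space (Metric_space.mtopology
      (L1_space (restrict_space M S) :: ('a \<Rightarrow> real) set set) (L1_dist (restrict_space M S)))"
    using not_sat unfolding saturated_def by blast
  then obtain Q where Q: "countable Q" "\<forall>q\<in>Q. integrable M q"
    and dense': "\<forall>f. integrable M f \<longrightarrow> (\<forall>e>0. \<exists>q\<in>Q. (\<integral>x. indicator S x * \<bar>f x - q x\<bar> \<partial>M) < (e::real))"
    unfolding separable_L1_restrict_iff[OF S] by (elim exE conjE)
  note dense = dense'[rule_format]
  have "Q \<noteq> {}" using dense[of "\<lambda>_. 0" 1] by auto
  define h where "h n t = indicator S t * from_nat_into Q n t" for n t
  have q_int: "integrable M (from_nat_into Q n)" for n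
    using Q(2) from_nat_into[OF \<open>Q \<noteq> {}\<close>] by blast
  have h_int: "integrable M (h n)" for n
    using integrable_mult_indicator[OF S q_int[of n]] by (simp add: h_def[abs_def])
  obtain x :: "nat \<Rightarrow> 'e" and \<phi> :: "nat \<Rightarrow> 'e \<Rightarrow> real" where \<phi>: "\<And>n. bounded_linear (\<phi> n)"
    and diag: "\<And>n. \<phi> n (x n) \<noteq> 0" and tri: "\<And>n k. n < k \<Longrightarrow> \<phi> n (x k) = 0"
    by (rule triangular_system[OF infinite_dim]) blast
  \<comment> \<open>The weights bring the \<open>n\<close>-th term of the series below
    \<open>(1 / 2) ^ n\<close> in mean norm; the \<open>+ 1\<close> in both factors prevents
    division by zero.\<close>
  define c where "c n = (1 / 2) ^ n / (((\<integral>t. \<bar>h n t\<bar> \<partial>M) + 1) * (norm (x n) + 1))" for n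
  have pos: "(\<integral>t. \<bar>h n t\<bar> \<partial>M) + 1 > 0" "norm (x n) + 1 > 0" for n
    by (intro add_nonneg_pos; simp)+
  then have c_pos: "c n > 0" for n by (simp add: c_def)
  have c_le: "c n * (\<integral>t. \<bar>h n t\<bar> \<partial>M) * norm (x n) \<le> (1 / 2) ^ n" for n
  proof -
    have "(\<integral>t. \<bar>h n t\<bar> \<partial>M) * norm (x n) \<le> ((\<integral>t. \<bar>h n t\<bar> \<partial>M) + 1) * (norm (x n) + 1)"
      by (intro mult_mono) auto
    then have "c n * ((\<integral>t. \<bar>h n t\<bar> \<partial>M) * norm (x n)) \<le> c n * (((\<integral>t. \<bar>h n t\<bar> \<partial>M) + 1) * (norm (x n) + 1))"
      using c_pos[of n] by (intro mult_left_mono) auto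
    also have "\<dots> = (1 / 2) ^ n"
      using pos[of n] unfolding c_def by (intro nonzero_eq_divide_eq[THEN iffD1] refl) auto
    finally show ?thesis by (simp add: mult.assoc)
  qed
  define g where "g n t = (c n * h n t) *\<^sub>R x n" for n t
  define f where "f t = (\<Sum>n. g n t)" for t
  have g_int: "integrable M (g n)" for n
    unfolding g_def using h_int[of n] by (intro integrable_scaleR_left) auto
  have norm_g: "(\<integral>t. norm (g n t) \<partial>M) = c n * (\<integral>t. \<bar>h n t\<bar> \<partial>M) * norm (x n)" for n
    using c_pos[of n] by (simp add: g_def abs_mult)
  have summ: "summable (\<lambda>n. \<integral>t. norm (g n t) \<partial>M)"
    by (rule summable_comparison_test'[where g = "\<lambda>n. (1 / 2) ^ n" and N = 0])
      (use c_le c_pos in \<open>auto simp: norm_g less_imp_le\<close>)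
  have AE_summ: "AE t in M. summable (\<lambda>n. norm (g n t))"
    by (rule AE_summable_of_summable_integrals[OF g_int summ])
  have f_int: "integrable M f"
    unfolding f_def by (rule integrable_suminf[OF g_int AE_summ summ])
  have f_sums: "(\<lambda>n. (c n * (\<integral>t. indicator A t * h n t \<partial>M)) *\<^sub>R x n) sums (\<integral>t. indicator A t *\<^sub>R f t \<partial>M)"
    if A[measurable]: "A \<in> sets M" for A
  proof -
    have int: "integrable M (\<lambda>t. indicator A t *\<^sub>R g n t)" for n
      by (rule integrable_mult_indicator[OF A g_int])
    have "(\<lambda>n. \<integral>t. indicator A t *\<^sub>R g n t \<partial>M) sums (\<integral>t. (\<Sum>n. indicator A t *\<^sub>R g n t) \<partial>M)"
    proof (rule sums_integral[OF int])
      show "AE t in M. summable (\<lambda>n. norm (indicator A t *\<^sub>R g n t))"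
        using AE_summ by eventually_elim (simp add: summable_mult)
      show "summable (\<lambda>n. \<integral>t. norm (indicator A t *\<^sub>R g n t) \<partial>M)"
      proof (rule summable_comparison_test'[OF summ, where N = 0])
        have "(\<integral>t. norm (indicator A t *\<^sub>R g n t) \<partial>M) \<le> (\<integral>t. norm (g n t) \<partial>M)" for n
          by (rule integral_mono[OF integrable_norm[OF int] integrable_norm[OF g_int]])
             (simp add: indicator_def)
        then show "norm (\<integral>t. norm (indicator A t *\<^sub>R g n t) \<partial>M) \<le> (\<integral>t. norm (g n t) \<partial>M)" for n
          by simp
      qed
    qed
    also have "(\<integral>t. (\<Sum>n. indicator A t *\<^sub>R g n t) \<partial>M) = (\<integral>t. indicator A t *\<^sub>R f t \<partial>M)"
    proof (rule Bochner_Integration.integral_cong[OF refl])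
      show "(\<Sum>n. indicator A t *\<^sub>R g n t) = indicator A t *\<^sub>R f t" for t
        by (cases "t \<in> A") (simp_all add: f_def)
    qed
    also have "(\<lambda>n. \<integral>t. indicator A t *\<^sub>R g n t \<partial>M) = (\<lambda>n. (c n * (\<integral>t. indicator A t * h n t \<partial>M)) *\<^sub>R x n)"
    proof
      fix n
      have "(\<integral>t. indicator A t *\<^sub>R g n t \<partial>M) = (\<integral>t. (c n * (indicator A t * h n t)) *\<^sub>R x n \<partial>M)"
        by (intro Bochner_Integration.integral_cong refl) (simp add: g_def mult_ac)
      also have "\<dots> = (c n * (\<integral>t. indicator A t * h n t \<partial>M)) *\<^sub>R x n"
        using integrable_mult_indicator[OF A h_int[of n]] by (subst integral_scaleR_left) auto
      finally show "(\<integral>t. indicator A t *\<^sub>R g n t \<partial>M) = (c n * (\<integral>t. indicator A t * h n t \<partial>M)) *\<^sub>R x n" .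
    qed
    finally show ?thesis .
  qed
  have "\<not> convex ((\<lambda>A. \<integral>t. indicator A t *\<^sub>R f t \<partial>M) ` sets M)"
  proof
    let ?m = "\<lambda>A. \<integral>t. indicator A t *\<^sub>R f t \<partial>M"
    assume "convex (?m ` sets M)"
    then have "(1 / 2) *\<^sub>R ?m S + (1 / 2) *\<^sub>R ?m {} \<in> ?m ` sets M"
      by (rule convexD[OF _ imageI[OF S] imageI[OF sets.empty_sets]]) auto
    then obtain D where D[measurable]: "D \<in> sets M" and mD: "?m D = (1 / 2) *\<^sub>R ?m S"
      by auto
    define a where "a n = (\<integral>t. indicator D t * h n t \<partial>M) - (1 / 2) * (\<integral>t. indicator S t * h n t \<partial>M)" for n
    have "(\<lambda>n. (c n * (\<integral>t. indicator D t * h n t \<partial>M)) *\<^sub>R x n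
        - (1 / 2) *\<^sub>R ((c n * (\<integral>t. indicator S t * h n t \<partial>M)) *\<^sub>R x n)) sums (?m D - (1 / 2) *\<^sub>R ?m S)"
      by (intro sums_diff sums_scaleR_right f_sums D S)
    then have a_sums: "(\<lambda>n. (c n * a n) *\<^sub>R x n) sums 0"
      by (simp add: mD a_def right_diff_distrib scaleR_left_diff_distrib mult_ac)
    have a0: "a n = 0" for n
    \<comment> \<open>Applying \<open>\<phi> n\<close> to the series isolates the
      \<open>n\<close>-th coefficient: earlier terms vanish by the induction hypothesis, later ones
      by triangularity.\<close>
    proof (induction n rule: less_induct)
      case (less n)
      have "(\<lambda>k. \<phi> n ((c k * a k) *\<^sub>R x k)) sums \<phi> n 0"
        by (rule bounded_linear.sums[OF \<phi> a_sums])
      moreover have "\<phi> n ((c k * a k) *\<^sub>R x k) = 0" if "k \<noteq> n" for k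
        using less[of k] tri[of n k] that by (cases "k < n") (simp_all add: linear_simps[OF \<phi>])
      then have "(\<lambda>k. \<phi> n ((c k * a k) *\<^sub>R x k)) sums (\<Sum>k\<in>{n}. \<phi> n ((c k * a k) *\<^sub>R x k))"
        by (intro sums_finite) auto
      ultimately have "\<phi> n ((c n * a n) *\<^sub>R x n) = \<phi> n 0"
        using sums_unique2 by fastforce
      then show ?case using diag[of n] c_pos[of n] by (simp add: linear_simps[OF \<phi>])
    qed
    define w :: "'a \<Rightarrow> real" where "w t = indicator D t - 1 / 2" for t
    have [measurable]: "w \<in> borel_measurable M" unfolding w_def by measurable
    have w_abs: "\<bar>w t\<bar> = 1 / 2" for t by (simp add: w_def indicator_def)
    have w_int: "integrable M w"
      by (rule integrable_const_bound[of _ 1]) (simp_all add: w_abs)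
    have wh: "(\<integral>t. w t * h n t \<partial>M) = 0" for n
    proof -
      have "(\<integral>t. w t * h n t \<partial>M) = (\<integral>t. indicator D t * h n t - (1 / 2) * (indicator S t * h n t) \<partial>M)"
        by (intro Bochner_Integration.integral_cong refl) (auto simp: w_def h_def left_diff_distrib indicator_def)
      also have "\<dots> = a n"
        unfolding a_def using integrable_mult_indicator[OF D h_int[of n]] integrable_mult_indicator[OF S h_int[of n]]
        by simp
      finally show ?thesis using a0 by simp
    qed
    have meas_S: "measure M S > 0" using S_pos by (simp add: emeasure_eq_measure)
    \<comment> \<open>The function approximated over \<open>S\<close> is \<open>w\<close> itself, by
      a member of the family to which it is orthogonal.\<close>
    then obtain q where q: "q \<in> Q" "(\<integral>t. indicator S t * \<bar>w t - q t\<bar> \<partial>M) < measure M S / 2"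
      using dense[OF w_int, of "measure M S / 2"] by auto
    obtain n where n: "q = from_nat_into Q n" using from_nat_into_surj[OF Q(1) q(1)] by metis
    have ww: "w t * w t = 1 / 4" for t by (simp add: w_def indicator_def)
    have int1: "integrable M (\<lambda>t. w t * h n t)"
      by (rule integrable_mult_bounded[where C = 1]) (simp_all add: w_abs h_int)
    have int2: "integrable M (\<lambda>t. indicator S t * (w t - q t))"
      using integrable_mult_indicator[OF S, of "\<lambda>t. w t - q t"] w_int q_int[of n] by (simp add: n)
    have int3: "integrable M (\<lambda>t. w t * (indicator S t * (w t - q t)))"
      by (rule integrable_mult_bounded[where C = 1]) (simp_all add: w_abs int2)
    have int4: "integrable M (\<lambda>t. indicator S t * \<bar>w t - q t\<bar>)"
      using integrable_mult_indicator[OF S, of "\<lambda>t. \<bar>w t - q t\<bar>"] w_int q_int[of n] by (simp add: n)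
    \<comment> \<open>The integral of \<open>w * w\<close> over \<open>S\<close> is
      \<open>measure M S / 4\<close>. Subtracting the vanishing integral of \<open>w * h n\<close>
      replaces one factor by \<open>w - q\<close>, and the choice of \<open>q\<close> makes the
      result strictly smaller than \<open>measure M S / 4\<close>.\<close>
    have "measure M S / 4 = (\<integral>t. (1 / 4) * indicator S t \<partial>M)" by simp
    also have "\<dots> = (\<integral>t. w t * (indicator S t * (w t - q t)) + w t * h n t \<partial>M)"
    proof (rule Bochner_Integration.integral_cong[OF refl])
      fix t
      have "w t * (indicator S t * (w t - q t)) + w t * h n t = w t * w t * indicator S t"
        by (simp add: h_def n algebra_simps)
      then show "(1 / 4) * indicator S t = w t * (indicator S t * (w t - q t)) + w t * h n t"
        by (simp add: ww)
    qed
    also have "\<dots> = (\<integral>t. w t * (indicator S t * (w t - q t)) \<partial>M)"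
      using int1 int3 wh by simp
    also have "\<dots> \<le> (\<integral>t. (1 / 2) * (indicator S t * \<bar>w t - q t\<bar>) \<partial>M)"
    proof (rule integral_mono[OF int3])
      fix t
      have "w t * (indicator S t * (w t - q t)) \<le> \<bar>w t\<bar> * \<bar>indicator S t * (w t - q t)\<bar>"
        unfolding abs_mult[symmetric] by (rule abs_ge_self)
      then show "w t * (indicator S t * (w t - q t)) \<le> (1 / 2) * (indicator S t * \<bar>w t - q t\<bar>)"
        by (simp add: w_abs abs_mult)
    qed (use int4 in simp)
    also have "\<dots> < measure M S / 4" using q(2) by simp
    finally show False by simp
  qed
  with f_int show ?thesis by (rule that)
qed

theorem corollary3p1:
  fixes M :: "'a measure"
  assumes "finite_measure M" and "complete_measure M"
  shows
    "((\<nexists>B :: 'e::{banach,second_countable_topology} set. finite B \<and> span B = UNIV) \<longrightarrow>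
        (saturated M \<longleftrightarrow>
          (\<forall>m :: 'a set \<Rightarrow> 'e. vector_measure M m \<and> mu_continuous M m \<longrightarrow>
             compactin weak_topology (m ` sets M) \<and> convex (m ` sets M))) \<and>
        (saturated M \<longleftrightarrow>
          (\<forall>K :: ('a \<Rightarrow> 'e) set set. K \<noteq> {} \<and> decomposable M K \<longrightarrow>
             convex (L1_integral M ` K)))) \<and>
     (saturated M \<longrightarrow>
        (\<forall>m :: 'a set \<Rightarrow> 'e. vector_measure M m \<and> mu_continuous M m \<longrightarrow>
           compactin weak_topology (m ` sets M) \<and> convex (m ` sets M))) \<and>
     (saturated M \<longrightarrow>
        (\<forall>K :: ('a \<Rightarrow> 'e) set set. K \<noteq> {} \<and> decomposable M K \<longrightarrow>
           convex (L1_integral M ` K)))"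
    (is "(?inf \<longrightarrow> (_ \<longleftrightarrow> ?ii) \<and> (_ \<longleftrightarrow> ?iii)) \<and> _ \<and> _")
proof -
  note fin = assms(1)
  have ii: ?ii if "saturated M"
    using saturated_weakly_compact_range[OF fin that] saturated_convex_range[OF fin that] by blast
  have iii: ?iii if "saturated M"
    using decomposable_integrals_convex[OF fin that] by blast
  \<comment> \<open>A single integrable \<open>f\<close> refutes both conditions: its indefinite
    integral is a vector measure with nonconvex range, and its cut-offs to measurable sets form a
    nonempty decomposable set with the same integrals.\<close>
  have sat: "saturated M" if ?inf and "?ii \<or> ?iii"
  proof (rule ccontr)
    assume "\<not> saturated M"
    then obtain f :: "'a \<Rightarrow> 'e" where f: "integrable M f"
      and nonconvex: "\<not> convex ((\<lambda>A. \<integral>x. indicator A x *\<^sub>R f x \<partial>M) ` sets M)"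
      using not_saturated_nonconvex_range[OF fin _ \<open>?inf\<close>] by blast
    have "\<not> ?ii"
      using indefinite_integral_vector_measure[OF f] nonconvex by blast
    moreover have "\<not> ?iii"
      using decomposable_indicator_multiples[OF f] nonconvex sets.empty_sets[of M]
      by (metis (no_types, lifting) empty_iff image_is_empty)
    ultimately show False using that(2) by blast
  qed
  from ii iii sat show ?thesis by blast
qed

end
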